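(* Let $\Gamma$ be a finitely presented group which is an extension of an amenable group with solvable Word Problem by an Abelian group; that is, $\Gamma$ has an Abelian normal subgroup $N$ such that $\Gamma/N$ is amenable and has solvable Word Problem. Then $\Gamma$ has computable F\o lner sets.
   Context: For a group $\Gamma$ generated by a finite set $X$, let $\pi_{\Gamma,X}\colon \mathbb F_X\to\Gamma$ be the canonical epimorphism from the free group on $X$. For a positive integer $n$, an $n$-F\o lner set of $\Gamma$ (with respect to $X$) is a non-empty finite subset $F\subset\Gamma$ with $\frac{|F\setminus xF|}{|F|}\le n^{-1}$ for all $x\in X$. $\Gamma$ is amenable if it admits $n$-F\o lner sets for all $n$. $\Gamma$ has computable F\o lner sets (with respect to $X$) if there is an algorithm which, on input $n$, outputs a finite subset $F\subset\mathbb F_X$ such that $\pi_{\Gamma,X}(F)$ is $n$-F\o lner for $\Gamma$. This property does not depend on the choice of the finite generating set. The Abelian group $N$ is not assumed to be finitely generated. *)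

theory Defs
  imports Complex_Main "HOL-Algebra.Generated_Groups" "HOL-Library.Nat_Bijection"
begin

section \<open>Computability of functions on the natural numbers\<close>

text \<open>Algorithms are modelled by partial recursive functions. \<open>rec_eval r xs y\<close> says that
  the program \<open>r\<close> halts on the argument list \<open>xs\<close> with value \<open>y\<close>.\<close>

datatype recf =
    Zero
  | Succ
  | Proj nat
  | Comp recf "recf list"
  | PRec recf recf
  | Mu recf

inductive rec_eval :: "recf \<Rightarrow> nat list \<Rightarrow> nat \<Rightarrow> bool" where
  zero: "rec_eval Zero xs 0"
| succ: "rec_eval Succ [x] (Suc x)"
| proj: "i < length xs \<Longrightarrow> rec_eval (Proj i) xs (xs ! i)"
| comp: "length ys = length gs \<Longrightarrow> (\<forall>i < length gs. rec_eval (gs ! i) xs (ys ! i)) \<Longrightarrow>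
    rec_eval f ys z \<Longrightarrow> rec_eval (Comp f gs) xs z"
| prec_0: "rec_eval f xs z \<Longrightarrow> rec_eval (PRec f g) (0 # xs) z"
| prec_Suc: "rec_eval (PRec f g) (n # xs) y \<Longrightarrow> rec_eval g (n # y # xs) z \<Longrightarrow>
    rec_eval (PRec f g) (Suc n # xs) z"
| mu: "rec_eval f (n # xs) 0 \<Longrightarrow> (\<forall>m < n. \<exists>y. rec_eval f (m # xs) (Suc y)) \<Longrightarrow>
    rec_eval (Mu f) xs n"

lemma rec_eval_deterministic: "rec_eval r xs y \<Longrightarrow> rec_eval r xs z \<Longrightarrow> y = z"
proof (induction r xs y arbitrary: z rule: rec_eval.induct)
  case (zero xs)
  then show ?case by (auto elim: rec_eval.cases)
next
  case (succ x)
  then show ?case by (auto elim: rec_eval.cases)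
next
  case (proj i xs)
  from proj(2) show ?case by cases auto
next
  case (comp ys gs xs f v)
  from comp.prems obtain ys' where ys': "length ys' = length gs"
      "\<forall>i < length gs. rec_eval (gs ! i) xs (ys' ! i)" "rec_eval f ys' z"
    by cases auto
  have "ys = ys'"
    using comp.hyps(1) comp.IH ys' by (intro nth_equalityI) auto
  with comp.IH ys' show ?case by auto
next
  case (prec_0 f xs v g)
  from prec_0.prems show ?case by cases (auto intro: prec_0.IH)
next
  case (prec_Suc f g n xs y v)
  from prec_Suc.prems obtain y' where "rec_eval (PRec f g) (n # xs) y'" "rec_eval g (n # y' # xs) z"
    by cases auto
  with prec_Suc.IH show ?case by blast
next
  case (mu f n xs)
  from mu.prems have z: "rec_eval f (z # xs) 0" "\<forall>m < z. \<exists>y. rec_eval f (m # xs) (Suc y)"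
    by (cases; auto)+
  show ?case
  proof (rule linorder_cases[of n z])
    assume "n < z"
    with z(2) mu.IH(1) show ?thesis by fastforce
  next
    assume "z < n"
    with mu.IH(2) z(1) show ?thesis by fastforce
  qed
qed

definition computable :: "(nat \<Rightarrow> nat) \<Rightarrow> bool" where
  "computable f \<longleftrightarrow> (\<exists>r. \<forall>n. rec_eval r [n] (f n))"

definition decidable :: "nat set \<Rightarrow> bool" where
  "decidable A \<longleftrightarrow> computable (\<lambda>n. if n \<in> A then 1 else 0)"


section \<open>Free groups\<close>

text \<open>\<open>(x, True)\<close> stands for the generator \<open>x\<close> and \<open>(x, False)\<close> for its inverse.
  The elements of the free group on \<open>X\<close> are the reduced words.\<close>

type_synonym 'a word = "('a \<times> bool) list"

definition inv_letter :: "'a \<times> bool \<Rightarrow> 'a \<times> bool" where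
  "inv_letter l = (fst l, \<not> snd l)"

definition words :: "'a set \<Rightarrow> 'a word set" where
  "words X = lists (X \<times> UNIV)"

definition reduced :: "'a word \<Rightarrow> bool" where
  "reduced w \<longleftrightarrow> successively (\<lambda>l m. m \<noteq> inv_letter l) w"

fun cons_reduce :: "'a \<times> bool \<Rightarrow> 'a word \<Rightarrow> 'a word" where
  "cons_reduce l [] = [l]"
| "cons_reduce l (m # w) = (if m = inv_letter l then w else l # m # w)"

definition reduce :: "'a word \<Rightarrow> 'a word" where
  "reduce w = foldr cons_reduce w []"

definition free_group :: "'a set \<Rightarrow> 'a word monoid" where
  "free_group X = \<lparr>carrier = {w \<in> words X. reduced w}, monoid.mult = (\<lambda>u v. reduce (u @ v)), one = []\<rparr>"

lemma inv_letter_inv_letter [simp]: "inv_letter (inv_letter l) = l"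
  by (simp add: inv_letter_def)

lemma reduced_cons_reduce: "reduced w \<Longrightarrow> reduced (cons_reduce l w)"
  by (cases w rule: list.exhaust; cases "tl w" rule: list.exhaust) (auto simp: reduced_def)

lemma reduced_foldr: "reduced w \<Longrightarrow> reduced (foldr cons_reduce u w)"
  by (induction u) (auto simp: reduced_cons_reduce)

lemma reduced_reduce: "reduced (reduce w)"
  unfolding reduce_def by (rule reduced_foldr) (simp add: reduced_def)

lemma set_cons_reduce: "set (cons_reduce l w) \<subseteq> insert l (set w)"
  by (cases w) auto

lemma set_reduce: "set (reduce w) \<subseteq> set w"
  unfolding reduce_def using set_cons_reduce by (induction w) fastforce+

lemma words_reduce: "w \<in> words X \<Longrightarrow> reduce w \<in> words X"
  using set_reduce by (auto simp: words_def lists_eq_set)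

lemma reduce_reduced: "reduced w \<Longrightarrow> reduce w = w"
proof (induction w)
  case Nil
  show ?case by (simp add: reduce_def)
next
  case (Cons l w)
  then show ?case by (cases w) (auto simp: reduce_def reduced_def)
qed

lemma cons_reduce_cancel: "reduced w \<Longrightarrow> cons_reduce l (cons_reduce (inv_letter l) w) = w"
  by (cases w rule: list.exhaust; cases "tl w" rule: list.exhaust) (auto simp: reduced_def)

lemma foldr_cons_reduce:
  assumes "reduced w"
  shows "foldr cons_reduce (cons_reduce l u) w = cons_reduce l (foldr cons_reduce u w)"
proof (cases u)
  case (Cons m v)
  show ?thesis
  proof (cases "m = inv_letter l")
    case True
    with Cons assms show ?thesis by (simp add: cons_reduce_cancel reduced_foldr)
  qed (use Cons in simp)
qed simp

lemma foldr_reduce: "reduced w \<Longrightarrow> foldr cons_reduce (reduce u) w = foldr cons_reduce u w"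
  by (induction u) (simp_all add: reduce_def foldr_cons_reduce)

lemma reduce_append: "reduce (u @ v) = foldr cons_reduce u (reduce v)"
  by (simp add: reduce_def)

lemma reduce_append_reduce_left: "reduce (reduce u @ v) = reduce (u @ v)"
  by (simp add: reduce_append foldr_reduce reduced_reduce)

lemma reduce_append_reduce_right: "reduce (u @ reduce v) = reduce (u @ v)"
  by (simp add: reduce_append reduce_reduced reduced_reduce)

lemma reduce_inverse: "reduce (rev (map inv_letter w) @ w) = []"
proof (induction w)
  case Nil
  show ?case by (simp add: reduce_def)
next
  case (Cons l w)
  have "cons_reduce (inv_letter l) (cons_reduce l (reduce w)) = reduce w"
    using cons_reduce_cancel[OF reduced_reduce, of "inv_letter l" w] by simp
  with Cons show ?case by (simp add: reduce_append) (simp add: reduce_def)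
qed

lemma group_free_group: "group (free_group X)"
proof (rule groupI)
  fix u v w
  assume "u \<in> carrier (free_group X)" "v \<in> carrier (free_group X)" "w \<in> carrier (free_group X)"
  then show "u \<otimes>\<^bsub>free_group X\<^esub> v \<otimes>\<^bsub>free_group X\<^esub> w = u \<otimes>\<^bsub>free_group X\<^esub> (v \<otimes>\<^bsub>free_group X\<^esub> w)"
    by (simp add: free_group_def reduce_append_reduce_left reduce_append_reduce_right)
next
  fix u v
  assume "u \<in> carrier (free_group X)" "v \<in> carrier (free_group X)"
  then have "u @ v \<in> words X" by (auto simp: free_group_def words_def)
  then show "u \<otimes>\<^bsub>free_group X\<^esub> v \<in> carrier (free_group X)"
    by (simp add: free_group_def reduced_reduce words_reduce)
next
  fix u
  assume u: "u \<in> carrier (free_group X)"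
  let ?v = "reduce (rev (map inv_letter u))"
  have "rev (map inv_letter u) \<in> words X"
    using u by (force simp: free_group_def words_def inv_letter_def)
  then have "?v \<in> carrier (free_group X)"
    by (simp add: free_group_def reduced_reduce words_reduce)
  moreover have "?v \<otimes>\<^bsub>free_group X\<^esub> u = \<one>\<^bsub>free_group X\<^esub>"
    by (simp add: free_group_def reduce_append_reduce_left reduce_inverse)
  ultimately show "\<exists>v \<in> carrier (free_group X). v \<otimes>\<^bsub>free_group X\<^esub> u = \<one>\<^bsub>free_group X\<^esub>"
    by blast
qed (auto simp: free_group_def words_def reduced_def reduce_reduced)


section \<open>Finitely generated and finitely presented groups\<close>

definition generating_set :: "('a, 'b) monoid_scheme \<Rightarrow> 'a set \<Rightarrow> bool" where
  "generating_set G X \<longleftrightarrow> finite X \<and> X \<subseteq> carrier G \<and> generate G X = carrier G"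

text \<open>The restriction of \<open>word_eval G\<close> to \<open>free_group X\<close> is the canonical homomorphism to \<open>G\<close>;
  it is also defined on words that are not reduced.\<close>

definition word_eval :: "('a, 'b) monoid_scheme \<Rightarrow> 'a word \<Rightarrow> 'a" where
  "word_eval G w = foldr (\<lambda>(x, s) g. (if s then x else inv\<^bsub>G\<^esub> x) \<otimes>\<^bsub>G\<^esub> g) w \<one>\<^bsub>G\<^esub>"

lemma (in group) word_eval_hom:
  assumes "X \<subseteq> carrier G"
  shows "word_eval G \<in> hom (free_group X) G"
proof -
  let ?e = "\<lambda>l. if snd l then fst l else inv\<^bsub>G\<^esub> (fst l)"
  have eval_Cons: "word_eval G (l # w) = ?e l \<otimes> word_eval G w" for l w
    by (simp add: word_eval_def case_prod_unfold)
  have e: "?e l \<in> carrier G" if "fst l \<in> X" for l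
    using that assms by auto
  have closed: "word_eval G w \<in> carrier G" if "w \<in> words X" for w
    using that
  proof (induction w)
    case Nil
    show ?case by (simp add: word_eval_def)
  next
    case (Cons l w)
    then have "w \<in> words X" "fst l \<in> X" by (auto simp: words_def)
    with Cons.IH e show ?case by (simp only: eval_Cons m_closed)
  qed
  have append: "word_eval G (u @ v) = word_eval G u \<otimes> word_eval G v"
    if "u \<in> words X" "v \<in> words X" for u v
    using that(1)
  proof (induction u)
    case Nil
    show ?case using closed[OF that(2)] by (simp add: word_eval_def)
  next
    case (Cons l w)
    then have w: "w \<in> words X" "fst l \<in> X" by (auto simp: words_def)
    have "word_eval G ((l # w) @ v) = ?e l \<otimes> (word_eval G w \<otimes> word_eval G v)"
      using Cons.IH w by (simp only: append_Cons eval_Cons)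
    also have "\<dots> = word_eval G (l # w) \<otimes> word_eval G v"
      using m_assoc[OF e[OF w(2)] closed[OF w(1)] closed[OF that(2)]] by (simp only: eval_Cons)
    finally show ?case .
  qed
  have cons_reduce: "word_eval G (cons_reduce l w) = word_eval G (l # w)"
    if "w \<in> words X" "fst l \<in> X" for l w
  proof (cases w)
    case (Cons m v)
    with that have v: "v \<in> words X" "fst l \<in> carrier G" using assms by (auto simp: words_def)
    show ?thesis
    proof (cases "m = inv_letter l")
      case True
      then have "word_eval G (l # w) = (?e l \<otimes> ?e m) \<otimes> word_eval G v"
        using v closed[OF v(1)] m_assoc[of "?e l" "?e m" "word_eval G v"]
        by (simp add: \<open>w = m # v\<close> eval_Cons inv_letter_def)
      also have "?e l \<otimes> ?e m = \<one>"
        using True v by (simp add: inv_letter_def)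
      finally show ?thesis
        using True closed[OF v(1)] by (simp add: \<open>w = m # v\<close>)
    qed (simp add: \<open>w = m # v\<close>)
  qed simp
  have reduce: "word_eval G (reduce w) = word_eval G w" if "w \<in> words X" for w
    using that
  proof (induction w)
    case Nil
    show ?case by (simp add: reduce_def)
  next
    case (Cons l w)
    then have w: "w \<in> words X" "fst l \<in> X" by (auto simp: words_def)
    have "word_eval G (reduce (l # w)) = word_eval G (l # reduce w)"
      using cons_reduce[OF words_reduce[OF w(1)] w(2)] by (simp add: reduce_def)
    also have "\<dots> = word_eval G (l # w)"
      using Cons.IH w by (simp only: eval_Cons)
    finally show ?case .
  qed
  show ?thesis
  proof (rule homI)
    fix u v
    assume "u \<in> carrier (free_group X)" "v \<in> carrier (free_group X)"
    then have uv: "u \<in> words X" "v \<in> words X" by (auto simp: free_group_def)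
    then have "u @ v \<in> words X" by (auto simp: words_def)
    with uv show "word_eval G (u \<otimes>\<^bsub>free_group X\<^esub> v) = word_eval G u \<otimes> word_eval G v"
      by (simp add: free_group_def reduce append)
  qed (simp add: free_group_def closed)
qed

definition normal_closure :: "('a, 'b) monoid_scheme \<Rightarrow> 'a set \<Rightarrow> 'a set" where
  "normal_closure G R =
     generate G {g \<otimes>\<^bsub>G\<^esub> r \<otimes>\<^bsub>G\<^esub> inv\<^bsub>G\<^esub> g | g r. g \<in> carrier G \<and> r \<in> R}"

definition finitely_presented :: "('a, 'b) monoid_scheme \<Rightarrow> bool" where
  "finitely_presented G \<longleftrightarrow>
     (\<exists>X R. generating_set G X \<and> finite R \<and> R \<subseteq> carrier (free_group X) \<and>
        kernel (free_group X) G (word_eval G) = normal_closure (free_group X) R)"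


section \<open>Word problem and Foelner sets\<close>

text \<open>Words are coded by natural numbers via a numbering \<open>c\<close> of the generators. The set \<open>X\<close> of
  generators is finite below, so any two injective numberings differ by a finite table.\<close>

definition word_code :: "('a \<Rightarrow> nat) \<Rightarrow> 'a word \<Rightarrow> nat" where
  "word_code c w = list_encode (map (\<lambda>(x, s). prod_encode (c x, if s then 0 else 1)) w)"

definition solvable_WP_wrt :: "('a, 'b) monoid_scheme \<Rightarrow> 'a set \<Rightarrow> ('a \<Rightarrow> nat) \<Rightarrow> bool" where
  "solvable_WP_wrt G X c \<longleftrightarrow> decidable (word_code c ` {w \<in> words X. word_eval G w = \<one>\<^bsub>G\<^esub>})"

definition folner_set :: "('a, 'b) monoid_scheme \<Rightarrow> 'a set \<Rightarrow> nat \<Rightarrow> 'a set \<Rightarrow> bool" where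
  "folner_set G X n F \<longleftrightarrow> finite F \<and> F \<noteq> {} \<and> F \<subseteq> carrier G \<and>
     (\<forall>x \<in> X. real (card (F - (x <#\<^bsub>G\<^esub> F))) / real (card F) \<le> 1 / real n)"

definition amenable_wrt :: "('a, 'b) monoid_scheme \<Rightarrow> 'a set \<Rightarrow> bool" where
  "amenable_wrt G X \<longleftrightarrow> (\<forall>n \<ge> 1. \<exists>F. folner_set G X n F)"

text \<open>The output of the algorithm is a list of codes of reduced words, itself coded as a number.
  The value at \<open>n = 0\<close> is irrelevant.\<close>

definition computable_folner_wrt :: "('a, 'b) monoid_scheme \<Rightarrow> 'a set \<Rightarrow> ('a \<Rightarrow> nat) \<Rightarrow> bool" where
  "computable_folner_wrt G X c \<longleftrightarrow>
     (\<exists>f. computable f \<and>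
        (\<forall>n \<ge> 1. \<exists>F. finite F \<and> F \<subseteq> carrier (free_group X) \<and>
           set (list_decode (f n)) = word_code c ` F \<and>
           folner_set G X n (word_eval G ` F)))"

text \<open>None of the following three properties depends on the finite generating set or its numbering.
  The first two are used as hypotheses and ask for one choice; the last one is used as a conclusion
  and asks for all choices.\<close>

definition amenable :: "('a, 'b) monoid_scheme \<Rightarrow> bool" where
  "amenable G \<longleftrightarrow> (\<exists>X. generating_set G X \<and> amenable_wrt G X)"

definition solvable_word_problem :: "('a, 'b) monoid_scheme \<Rightarrow> bool" where
  "solvable_word_problem G \<longleftrightarrow>
     (\<exists>X c. generating_set G X \<and> inj_on c X \<and> solvable_WP_wrt G X c)"

definition computable_folner_sets :: "('a, 'b) monoid_scheme \<Rightarrow> bool" where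
  "computable_folner_sets G \<longleftrightarrow> (\<exists>X. generating_set G X) \<and>
     (\<forall>X c. generating_set G X \<and> inj_on c X \<longrightarrow> computable_folner_wrt G X c)"

end

theory Submission
  imports Defs
begin

text \<open>Write \<open>Q\<close> for the quotient of \<open>\<Gamma>\<close> by the Abelian normal subgroup \<open>N\<close>. The word problem of \<open>\<Gamma>\<close> itself may
  be unsolvable; then it is not possible to count the elements of \<open>\<Gamma>\<close> that a list of words represents,
  and hence to search for Foelner sets of \<open>\<Gamma>\<close> by testing. The proof avoids such tests.

  In \<open>Q\<close> everything can be tested, because its word problem is solvable. On input \<open>n\<close>, an unbounded
  search finds a list \<open>T\<close> of words that represent pairwise different elements of \<open>Q\<close> and whose image
  is a \<open>2 n\<close>-Foelner set of \<open>Q\<close>; it ends because \<open>Q\<close> is amenable (\<open>quotient_folner_exists\<close>). The elements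
  of \<open>T\<close> are permuted by a generator \<open>x\<close> up to factors in \<open>N\<close>, except for the few that leave \<open>T\<close>
  altogether: \<open>x t = u s\<close> with \<open>s = u\<inverse> x t\<close> in \<open>N\<close>. These finitely many elements \<open>s\<close> are
  found as words, again by deciding equality in \<open>Q\<close>.

  Let \<open>A\<close> be the set of all products of powers of these \<open>s\<close> with exponents below \<open>2 n\<close>. In every
  Abelian group, whatever relations hold between the elements \<open>s\<close>, the set \<open>A\<close> differs from each
  translate \<open>s A\<close> by at most the fraction \<open>1 / (2 n)\<close> (\<open>card_Diff_l_coset_power_box\<close>): in the direction of
  \<open>s\<close> it is a union of runs of at least \<open>2 n\<close> points, and a translation by \<open>s\<close> loses at most the
  first point of each run. So \<open>A\<close> needs no test at all, and the set of products of elements of \<open>T\<close> and \<open>A\<close> is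
  an \<open>n\<close>-Foelner set of \<open>\<Gamma>\<close> (\<open>card_Diff_l_coset_transversal\<close>). The output consists of the reduced words
  for these products, possibly with several words for one element.

  To see that this is an algorithm, computability is extended from natural numbers to booleans,
  pairs and lists, with closure rules for the usual list functions; the functions \<open>quotient_folner\<close> and
  \<open>folner_words\<close>, written as ordinary list functions, are then computable by their shape.\<close>

section \<open>Closure properties of the recursive functions\<close>

text \<open>Composition needs functions of several arguments, so the closure properties are first shown for
  functions of argument lists of a fixed length \<open>k\<close>.\<close>

definition recursive :: "nat \<Rightarrow> (nat list \<Rightarrow> nat) \<Rightarrow> bool" where
  "recursive k F \<longleftrightarrow> (\<exists>r. \<forall>xs. length xs = k \<longrightarrow> rec_eval r xs (F xs))"

lemma recursive_cong:
  assumes "recursive k F" "\<And>xs. length xs = k \<Longrightarrow> F xs = G xs"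
  shows "recursive k G"
  using assms unfolding recursive_def by metis

lemma computable_iff_recursive: "computable f \<longleftrightarrow> recursive 1 (\<lambda>xs. f (xs ! 0))"
proof
  assume "computable f"
  then obtain r where "rec_eval r [n] (f n)" for n by (auto simp: computable_def)
  then show "recursive 1 (\<lambda>xs. f (xs ! 0))"
    unfolding recursive_def by (intro exI[of _ r]) (auto simp: length_Suc_conv)
next
  assume "recursive 1 (\<lambda>xs. f (xs ! 0))"
  then obtain r where r: "length xs = 1 \<Longrightarrow> rec_eval r xs (f (xs ! 0))" for xs
    by (auto simp: recursive_def)
  then have "rec_eval r [n] (f n)" for n using r[of "[n]"] by simp
  then show "computable f" by (auto simp: computable_def)
qed

lemma recursive_nth: "i < k \<Longrightarrow> recursive k (\<lambda>xs. xs ! i)"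
  unfolding recursive_def by (intro exI[of _ "Proj i"]) (auto intro: rec_eval.proj)

lemma recursive_compose:
  assumes "recursive (length Gs) F" "\<And>G. G \<in> set Gs \<Longrightarrow> recursive k G"
  shows "recursive k (\<lambda>xs. F (map (\<lambda>G. G xs) Gs))"
proof -
  obtain r where r: "length ys = length Gs \<Longrightarrow> rec_eval r ys (F ys)" for ys
    using assms(1) by (auto simp: recursive_def)
  obtain s where s: "G \<in> set Gs \<Longrightarrow> length xs = k \<Longrightarrow> rec_eval (s G) xs (G xs)" for G xs
    using assms(2) unfolding recursive_def by metis
  have "rec_eval (Comp r (map s Gs)) xs (F (map (\<lambda>G. G xs) Gs))" if "length xs = k" for xs
    by (rule rec_eval.comp[where ys = "map (\<lambda>G. G xs) Gs"]) (auto intro: r s that)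
  then show ?thesis by (auto simp: recursive_def)
qed

lemma recursive_compose1:
  assumes "computable f" "recursive k G"
  shows "recursive k (\<lambda>xs. f (G xs))"
  using recursive_compose[of "[G]" "\<lambda>ys. f (ys ! 0)" k] assms
  by (simp add: computable_iff_recursive)

lemma recursive_compose2:
  assumes "recursive 2 (\<lambda>ys. f (ys ! 0) (ys ! 1))" "recursive k G" "recursive k H"
  shows "recursive k (\<lambda>xs. f (G xs) (H xs))"
  using recursive_compose[of "[G, H]" "\<lambda>ys. f (ys ! 0) (ys ! 1)" k] assms
  by (auto simp: numeral_2_eq_2)

lemma computable_Suc: "computable Suc"
  unfolding computable_def by (auto intro: rec_eval.succ)

lemma recursive_const: "recursive k (\<lambda>_. c)"
  using recursive_compose[of "[]" "\<lambda>_. 0" k]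
proof (induction c)
  case 0
  then show ?case by (auto simp: recursive_def intro: rec_eval.zero)
next
  case (Suc c)
  then show ?case using recursive_compose1[OF computable_Suc, of k "\<lambda>_. c"] by simp
qed

lemma computable_const: "computable (\<lambda>_. c)"
  by (simp add: computable_iff_recursive recursive_const)

text \<open>The step function receives the counter, the previous value and the parameters, in this order.\<close>

lemma recursive_rec_nat:
  assumes "recursive k F" "recursive (Suc (Suc k)) G"
  shows "recursive (Suc k) (\<lambda>xs. rec_nat (F (tl xs)) (\<lambda>n y. G (n # y # tl xs)) (hd xs))"
proof -
  obtain r where r: "length ys = k \<Longrightarrow> rec_eval r ys (F ys)" for ys
    using assms(1) by (auto simp: recursive_def)
  obtain s where s: "length ys = Suc (Suc k) \<Longrightarrow> rec_eval s ys (G ys)" for ys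
    using assms(2) by (auto simp: recursive_def)
  have "rec_eval (PRec r s) (n # ys) (rec_nat (F ys) (\<lambda>n y. G (n # y # ys)) n)"
    if "length ys = k" for n ys
  proof (induction n)
    case 0
    show ?case using rec_eval.prec_0[OF r[OF that]] by simp
  next
    case (Suc n)
    have "length (n # rec_nat (F ys) (\<lambda>n y. G (n # y # ys)) n # ys) = Suc (Suc k)"
      by (simp add: that)
    from rec_eval.prec_Suc[OF Suc s[OF this]] show ?case by simp
  qed
  then show ?thesis
    unfolding recursive_def by (intro exI[of _ "PRec r s"]) (auto simp: length_Suc_conv)
qed

text \<open>Minimization is used for total functions only, where it is the least-number operator.\<close>

lemma recursive_Least:
  assumes "recursive (Suc k) F" "\<And>xs. length xs = k \<Longrightarrow> \<exists>n. F (n # xs) = 0"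
  shows "recursive k (\<lambda>xs. LEAST n. F (n # xs) = 0)"
proof -
  obtain r where r: "length ys = Suc k \<Longrightarrow> rec_eval r ys (F ys)" for ys
    using assms(1) by (auto simp: recursive_def)
  have "rec_eval (Mu r) xs (LEAST n. F (n # xs) = 0)" if len: "length xs = k" for xs
  proof (rule rec_eval.mu)
    have *: "rec_eval r (n # xs) (F (n # xs))" for n by (simp add: r len)
    show "rec_eval r ((LEAST n. F (n # xs) = 0) # xs) 0"
      using *[of "LEAST n. F (n # xs) = 0"] LeastI_ex[OF assms(2)[OF len]] by simp
    show "\<forall>m<LEAST n. F (n # xs) = 0. \<exists>y. rec_eval r (m # xs) (Suc y)"
    proof (intro allI impI)
      fix m assume "m < (LEAST n. F (n # xs) = 0)"
      then have "F (m # xs) \<noteq> 0" by (rule not_less_Least)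
      then obtain y where "F (m # xs) = Suc y" using not0_implies_Suc by blast
      with *[of m] show "\<exists>y. rec_eval r (m # xs) (Suc y)" by auto
    qed
  qed
  then show ?thesis by (auto simp: recursive_def)
qed

lemma recursive_swap:
  assumes "recursive 2 (\<lambda>xs. f (xs ! 1) (xs ! 0))"
  shows "recursive 2 (\<lambda>xs. f (xs ! 0) (xs ! 1))"
  using recursive_compose2[of "\<lambda>x y. f y x", OF assms recursive_nth[of 1] recursive_nth[of 0]]
  by simp

text \<open>Every loop below is an iteration of a map that depends on a parameter; here the number of rounds
  is the first argument and the parameter the second one.\<close>

lemma recursive_iterate:
  assumes "recursive 2 (\<lambda>xs. s (xs ! 0) (xs ! 1))" "computable a"
  shows "recursive 2 (\<lambda>xs. (s (xs ! 1) ^^ (xs ! 0)) (a (xs ! 1)))"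
proof -
  have "recursive 3 (\<lambda>xs. s (xs ! 2) (xs ! 1))"
    by (rule recursive_compose2[OF assms(1)]) (simp_all add: recursive_nth)
  then have "recursive 2 (\<lambda>xs. rec_nat (a (tl xs ! 0)) (\<lambda>n y. s ((n # y # tl xs) ! 2) ((n # y # tl xs) ! 1)) (hd xs))"
    using recursive_rec_nat[of 1 "\<lambda>xs. a (xs ! 0)" "\<lambda>xs. s (xs ! 2) (xs ! 1)"] assms(2)
    by (simp add: computable_iff_recursive numeral_2_eq_2 numeral_3_eq_3)
  then show ?thesis
  proof (rule recursive_cong)
    fix xs :: "nat list" assume "length xs = 2"
    then obtain n x where xs: "xs = [n, x]" by (auto simp: length_Suc_conv numeral_2_eq_2)
    have "rec_nat (a x) (\<lambda>n y. s x y) n = (s x ^^ n) (a x)" by (induction n) auto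
    then show "rec_nat (a (tl xs ! 0)) (\<lambda>n y. s ((n # y # tl xs) ! 2) ((n # y # tl xs) ! 1)) (hd xs) =
        (s (xs ! 1) ^^ (xs ! 0)) (a (xs ! 1))"
      by (simp add: xs)
  qed
qed

lemma recursive_add: "recursive 2 (\<lambda>xs. xs ! 0 + xs ! 1)"
proof -
  have "recursive 2 (\<lambda>xs. Suc (xs ! 1))"
    by (rule recursive_compose1[OF computable_Suc]) (simp add: recursive_nth)
  then have "recursive 2 (\<lambda>xs. (Suc ^^ (xs ! 0)) (xs ! 1))"
    using recursive_nth[of 0 1] by (intro recursive_iterate) (auto simp: computable_iff_recursive)
  moreover have "(Suc ^^ n) m = n + m" for n m by (induction n) auto
  ultimately show ?thesis by simp
qed

lemma computable_rec_nat:
  assumes "recursive 2 (\<lambda>xs. g (xs ! 0) (xs ! 1))"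
  shows "computable (rec_nat c g)"
proof -
  have "recursive 1 (\<lambda>xs. rec_nat c (\<lambda>n y. g ((n # y # tl xs) ! 0) ((n # y # tl xs) ! 1)) (hd xs))"
    using recursive_rec_nat[of 0 "\<lambda>_. c" "\<lambda>xs. g (xs ! 0) (xs ! 1)"] assms
    by (simp add: recursive_const numeral_2_eq_2)
  then show ?thesis
    unfolding computable_iff_recursive
    by (rule recursive_cong) (auto simp: length_Suc_conv)
qed

lemma computable_pred: "computable (\<lambda>n. n - 1)"
proof -
  have "computable (rec_nat 0 (\<lambda>n _. n))"
    by (rule computable_rec_nat) (simp add: recursive_nth)
  moreover have "rec_nat 0 (\<lambda>n _. n) = (\<lambda>n. n - 1)"
  proof
    show "rec_nat 0 (\<lambda>n _. n) n = n - 1" for n by (cases n) auto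
  qed
  ultimately show ?thesis by simp
qed

lemma recursive_diff: "recursive 2 (\<lambda>xs. xs ! 0 - xs ! 1)"
proof (rule recursive_swap)
  have "recursive 2 (\<lambda>xs. xs ! 1 - 1)"
    by (rule recursive_compose1[OF computable_pred]) (simp add: recursive_nth)
  then have "recursive 2 (\<lambda>xs. ((\<lambda>y. y - 1) ^^ (xs ! 0)) (xs ! 1))"
    using recursive_nth[of 0 1]
    by (intro recursive_iterate) (auto simp: computable_iff_recursive)
  moreover have "((\<lambda>y. y - 1) ^^ n) m = m - n" for n m :: nat by (induction n) auto
  ultimately show "recursive 2 (\<lambda>xs. xs ! 1 - xs ! 0)" by simp
qed

lemma computable_triangle: "computable triangle"
proof -
  have "recursive 2 (\<lambda>xs. xs ! 1 + Suc (xs ! 0))"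
    by (intro recursive_compose2[OF recursive_add] recursive_compose1[OF computable_Suc])
      (simp_all add: recursive_nth)
  then have "computable (rec_nat 0 (\<lambda>n y. y + Suc n))"
    by (intro computable_rec_nat)
  moreover have "rec_nat 0 (\<lambda>n y. y + Suc n) = triangle"
  proof
    show "rec_nat 0 (\<lambda>n y. y + Suc n) n = triangle n" for n by (induction n) auto
  qed
  ultimately show ?thesis by simp
qed

lemma recursive_prod_encode: "recursive 2 (\<lambda>xs. prod_encode (xs ! 0, xs ! 1))"
  unfolding prod_encode_def prod.case
  by (intro recursive_compose2[OF recursive_add] recursive_compose1[OF computable_triangle])
    (simp_all add: recursive_nth)

text \<open>The pair coded by \<open>z\<close> lies on the diagonal \<open>s\<close>, the sum of its components, exactly when
  \<open>triangle s \<le> z < triangle (Suc s)\<close>, and its first component is \<open>z - triangle s\<close>.\<close>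

definition diagonal :: "nat \<Rightarrow> nat" where
  "diagonal z = (LEAST s. Suc z - triangle (Suc s) = 0)"

lemma diagonal_prod_encode: "diagonal (prod_encode (a, b)) = a + b"
  unfolding diagonal_def
proof (rule Least_equality)
  show "Suc (prod_encode (a, b)) - triangle (Suc (a + b)) = 0"
    by (simp add: prod_encode_def)
next
  fix s assume s: "Suc (prod_encode (a, b)) - triangle (Suc s) = 0"
  have mono: "triangle i \<le> triangle j" if "i \<le> j" for i j
    using that by (induction rule: dec_induct) auto
  show "a + b \<le> s"
  proof (rule ccontr)
    assume "\<not> a + b \<le> s"
    then have "triangle (Suc s) \<le> triangle (a + b)" by (intro mono) simp
    with s show False by (simp add: prod_encode_def del: triangle_Suc)
  qed
qed

lemma computable_diagonal: "computable diagonal"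
proof -
  have "recursive 2 (\<lambda>xs. Suc (xs ! 1) - triangle (Suc (xs ! 0)))"
    by (intro recursive_compose2[OF recursive_diff] recursive_compose1[OF computable_triangle]
        recursive_compose1[OF computable_Suc]) (simp_all add: recursive_nth)
  moreover have "\<exists>n. Suc z - triangle (Suc n) = 0" for z
    by (rule exI[of _ z]) simp
  ultimately have "recursive 1 (\<lambda>xs. LEAST n. Suc (xs ! 0) - triangle (Suc n) = 0)"
    using recursive_Least[of 1 "\<lambda>xs. Suc (xs ! 1) - triangle (Suc (xs ! 0))"]
    by (simp add: numeral_2_eq_2 del: triangle_Suc)
  then show ?thesis by (simp add: computable_iff_recursive diagonal_def[abs_def])
qed

lemma computable_compose: "computable f \<Longrightarrow> computable g \<Longrightarrow> computable (\<lambda>x. f (g x))"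
  using recursive_compose1[of f 1] by (simp add: computable_iff_recursive)

lemma computable_compose2:
  "recursive 2 (\<lambda>xs. f (xs ! 0) (xs ! 1)) \<Longrightarrow> computable g \<Longrightarrow> computable h \<Longrightarrow>
    computable (\<lambda>x. f (g x) (h x))"
  using recursive_compose2[of f 1] by (simp add: computable_iff_recursive)

lemma computable_id: "computable (\<lambda>x. x)"
  by (simp add: computable_iff_recursive recursive_nth)

lemma computable_fst_decode: "computable (\<lambda>z. fst (prod_decode z))"
proof -
  have "fst (prod_decode z) = z - triangle (diagonal z)" for z
  proof -
    obtain a b where z: "z = prod_encode (a, b)" by (metis prod_decode_inverse surj_pair)
    show ?thesis unfolding z diagonal_prod_encode by (simp, simp add: prod_encode_def)
  qed
  moreover have "computable (\<lambda>z. z - triangle (diagonal z))"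
    by (intro computable_compose2[OF recursive_diff] computable_id
        computable_compose[OF computable_triangle computable_diagonal])
  ultimately show ?thesis by simp
qed

lemma computable_snd_decode: "computable (\<lambda>z. snd (prod_decode z))"
proof -
  have "snd (prod_decode z) = diagonal z - fst (prod_decode z)" for z
  proof -
    obtain a b where "z = prod_encode (a, b)" by (metis prod_decode_inverse surj_pair)
    then show ?thesis by (simp add: diagonal_prod_encode)
  qed
  moreover have "computable (\<lambda>z. diagonal z - fst (prod_decode z))"
    by (intro computable_compose2[OF recursive_diff] computable_diagonal computable_fst_decode)
  ultimately show ?thesis by simp
qed

lemma computable_prod_encode:
  "computable f \<Longrightarrow> computable g \<Longrightarrow> computable (\<lambda>x. prod_encode (f x, g x))"
  using computable_compose2[of "\<lambda>a b. prod_encode (a, b)"] recursive_prod_encode by simp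

lemma recursive_pairing:
  "computable f \<Longrightarrow> recursive 2 (\<lambda>xs. f (prod_encode (xs ! 0, xs ! 1)))"
  by (rule recursive_compose1[OF _ recursive_prod_encode])

lemma computable_funpow:
  assumes "computable s" "computable n" "computable a"
  shows "computable (\<lambda>x. ((\<lambda>y. s (prod_encode (x, y))) ^^ n x) (a x))"
  by (rule computable_compose2[OF recursive_iterate[OF recursive_pairing[OF assms(1)] assms(3)]
        assms(2) computable_id])

lemma computable_Least:
  assumes "computable f" "\<And>x. \<exists>n. f (prod_encode (x, n)) = 0"
  shows "computable (\<lambda>x. LEAST n. f (prod_encode (x, n)) = 0)"
proof -
  have "recursive 2 (\<lambda>xs. f (prod_encode (xs ! 1, xs ! 0)))"
    by (intro recursive_compose1[OF assms(1)] recursive_compose2[OF recursive_prod_encode])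
      (simp_all add: recursive_nth)
  then have "recursive 1 (\<lambda>xs. LEAST n. f (prod_encode (xs ! 0, n)) = 0)"
    using recursive_Least[of 1 "\<lambda>xs. f (prod_encode (xs ! 1, xs ! 0))"] assms(2)
    by (simp add: numeral_2_eq_2)
  then show ?thesis by (simp add: computable_iff_recursive)
qed

lemma computable_if_zero:
  assumes "computable b" "computable f" "computable g"
  shows "computable (\<lambda>x. if b x = 0 then f x else g x)"
proof -
  \<comment> \<open>A constant map, iterated \<open>n\<close> times, is the identity for \<open>n = 0\<close> and that constant otherwise.\<close>
  have "((\<lambda>y. g x) ^^ n) a = (if n = 0 then a else g x)" for n a x by (cases n) auto
  moreover have "computable (\<lambda>x. ((\<lambda>y. g (fst (prod_decode (prod_encode (x, y))))) ^^ b x) (f x))"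
    by (rule computable_funpow[OF computable_compose[OF assms(3) computable_fst_decode] assms(1,2)])
  ultimately show ?thesis by simp
qed

section \<open>Computability for functions on data types\<close>

text \<open>A function between data types is effective if a computable function on natural numbers tracks it
  on codes. The codes of booleans, pairs and lists are chosen so that the code of a word over
  natural numbers is the one that \<^const>\<open>word_code\<close> assigns to it for the identity
  numbering; in particular \<^term>\<open>True\<close> has code 0. What the tracking function does outside the codes is left open.\<close>

class codable =
  fixes enc :: "'a \<Rightarrow> nat"

instantiation nat :: codable
begin
definition "enc_nat (n :: nat) = n"
instance ..
end

instantiation bool :: codable
begin
definition "enc_bool b = (if b then 0 else 1 :: nat)"
instance ..
end

instantiation prod :: (codable, codable) codable
begin
definition "enc_prod p = prod_encode (enc (fst p), enc (snd p))"
instance ..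
end

instantiation list :: (codable) codable
begin
definition "enc_list xs = list_encode (map enc xs)"
instance ..
end

definition effective :: "('a :: codable \<Rightarrow> 'b :: codable) \<Rightarrow> bool" where
  "effective f \<longleftrightarrow> (\<exists>g. computable g \<and> (\<forall>x. g (enc x) = enc (f x)))"

text \<open>These rules reduce effectiveness of a term to that of its parts. The argument \<open>x\<close> stands for the
  whole environment, and the body of a bound variable becomes a function of the pair of the
  environment and that variable.\<close>

named_theorems effective_intros

lemma effective_iff_computable: "effective f \<longleftrightarrow> computable (f :: nat \<Rightarrow> nat)"
proof
  assume "effective f"
  then obtain g where "computable g" "\<forall>x. g x = f x" by (auto simp: effective_def enc_nat_def)
  then show "computable f" by (simp add: ext[of g f])
qed (auto simp: effective_def enc_nat_def)

lemma effective_compose: "effective f \<Longrightarrow> effective g \<Longrightarrow> effective (\<lambda>x. f (g x))"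
  unfolding effective_def
proof (elim exE conjE)
  fix f' g' assume "computable f'" "computable g'" "\<forall>x. f' (enc x) = enc (f x)" "\<forall>x. g' (enc x) = enc (g x)"
  then show "\<exists>h. computable h \<and> (\<forall>x. h (enc x) = enc (f (g x)))"
    by (intro exI[of _ "\<lambda>x. f' (g' x)"]) (simp add: computable_compose)
qed

lemma effective_const [effective_intros]: "effective (\<lambda>_. c)"
  unfolding effective_def by (intro exI[of _ "\<lambda>_. enc c"]) (simp add: computable_const)

lemma effective_id [effective_intros]: "effective (\<lambda>x. x)"
  unfolding effective_def by (intro exI[of _ "\<lambda>x. x"]) (simp add: computable_id)

lemma effective_Pair [effective_intros]:
  "effective f \<Longrightarrow> effective g \<Longrightarrow> effective (\<lambda>x. (f x, g x))"
  unfolding effective_def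
proof (elim exE conjE)
  fix f' g' assume "computable f'" "computable g'" "\<forall>x. f' (enc x) = enc (f x)" "\<forall>x. g' (enc x) = enc (g x)"
  then show "\<exists>h. computable h \<and> (\<forall>x. h (enc x) = enc (f x, g x))"
    by (intro exI[of _ "\<lambda>x. prod_encode (f' x, g' x)"]) (simp add: computable_prod_encode enc_prod_def)
qed

lemma effective_fst [effective_intros]: "effective f \<Longrightarrow> effective (\<lambda>x. fst (f x))"
  by (rule effective_compose[of fst])
    (auto simp: effective_def enc_prod_def intro!: exI[of _ "\<lambda>z. fst (prod_decode z)"] computable_fst_decode)

lemma effective_snd [effective_intros]: "effective f \<Longrightarrow> effective (\<lambda>x. snd (f x))"
  by (rule effective_compose[of snd])
    (auto simp: effective_def enc_prod_def intro!: exI[of _ "\<lambda>z. snd (prod_decode z)"] computable_snd_decode)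

lemma effective_Cons [effective_intros]:
  "effective f \<Longrightarrow> effective g \<Longrightarrow> effective (\<lambda>x. f x # g x)"
  unfolding effective_def
proof (elim exE conjE)
  fix f' g' assume "computable f'" "computable g'" "\<forall>x. f' (enc x) = enc (f x)" "\<forall>x. g' (enc x) = enc (g x)"
  then show "\<exists>h. computable h \<and> (\<forall>x. h (enc x) = enc (f x # g x))"
    by (intro exI[of _ "\<lambda>x. Suc (prod_encode (f' x, g' x))"])
      (simp add: computable_prod_encode computable_compose[OF computable_Suc] enc_list_def)
qed

lemma effective_if [effective_intros]:
  "effective b \<Longrightarrow> effective f \<Longrightarrow> effective g \<Longrightarrow> effective (\<lambda>x. if b x then f x else g x)"
  unfolding effective_def
proof (elim exE conjE)
  fix b' f' g'
  assume "computable b'" "computable f'" "computable g'" "\<forall>x. b' (enc x) = enc (b x)"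
    "\<forall>x. f' (enc x) = enc (f x)" "\<forall>x. g' (enc x) = enc (g x)"
  then show "\<exists>h. computable h \<and> (\<forall>x. h (enc x) = enc (if b x then f x else g x))"
    by (intro exI[of _ "\<lambda>x. if b' x = 0 then f' x else g' x"])
      (auto simp: computable_if_zero enc_bool_def)
qed

lemma effective_funpow [effective_intros]:
  fixes s :: "'a :: codable \<Rightarrow> 'b :: codable \<Rightarrow> 'b"
  assumes "effective n" "effective a" "effective (\<lambda>p. s (fst p) (snd p))"
  shows "effective (\<lambda>x. (s x ^^ n x) (a x))"
proof -
  obtain n' a' s' where c: "computable n'" "computable a'" "computable s'"
    and n: "n' (enc x) = n x" and a: "a' (enc x) = enc (a x)"
    and s: "s' (enc p) = enc (s (fst p) (snd p))" for x p
    using assms by (auto simp: effective_def enc_nat_def)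
  have s: "s' (prod_encode (enc x, enc y)) = enc (s x y)" for x y
    using s[of "(x, y)"] by (simp add: enc_prod_def)
  have "((\<lambda>y. s' (prod_encode (enc x, y))) ^^ k) (enc y) = enc ((s x ^^ k) y)" for x y k
    by (induction k) (auto simp: s)
  then show ?thesis
    unfolding effective_def using c
    by (intro exI[of _ "\<lambda>x. ((\<lambda>y. s' (prod_encode (x, y))) ^^ n' x) (a' x)"])
      (simp add: n a computable_funpow)
qed

lemma length_le_list_encode: "length xs \<le> list_encode xs"
proof (induction xs)
  case (Cons x xs)
  then show ?case using le_prod_encode_2[of "list_encode xs" x] by simp
qed simp

lemma effective_fold [effective_intros]:
  assumes "effective xs" "effective a" "effective (\<lambda>p. s (fst p) (fst (snd p)) (snd (snd p)))"
  shows "effective (\<lambda>x. fold (s x) (xs x) (a x))"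
proof -
  obtain xs' a' s' where c: "computable xs'" "computable a'" "computable s'"
    and xs: "xs' (enc x) = enc (xs x)" and a: "a' (enc x) = enc (a x)"
    and s: "s' (enc p) = enc (s (fst p) (fst (snd p)) (snd (snd p)))" for x p
    using assms by (auto simp: effective_def enc_nat_def)
  have s: "s' (prod_encode (enc x, prod_encode (enc y, enc z))) = enc (s x y z)" for x y z
    using s[of "(x, y, z)"] by (simp add: enc_prod_def)
  \<comment> \<open>The state is the pair of the rest of the list and the accumulator; the parameter is carried along.\<close>
  define step where "step z = (let x = fst (prod_decode z); l = fst (prod_decode (snd (prod_decode z)));
      y = snd (prod_decode (snd (prod_decode z))); h = fst (prod_decode (l - 1)); t = snd (prod_decode (l - 1))
    in if l = 0 then snd (prod_decode z) else prod_encode (t, s' (prod_encode (x, prod_encode (h, y)))))" for z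
  have step: "computable step"
    unfolding step_def Let_def
    by (intro computable_if_zero computable_prod_encode computable_compose[OF c(3)]
        computable_compose[OF computable_fst_decode] computable_compose[OF computable_snd_decode]
        computable_compose[OF computable_pred] computable_id)
  \<comment> \<open>Once the list is exhausted the step does nothing, so any number of iterations that is at
    least the length will do; the code of the list is such a number.\<close>
  have iter: "((\<lambda>z. step (prod_encode (enc x, z))) ^^ k) (prod_encode (enc ys, enc y)) =
      prod_encode (0, enc (fold (s x) ys y))" if "length ys \<le> k" for x k ys y
    using that
  proof (induction k arbitrary: ys y)
    case 0
    then show ?case by (simp add: enc_list_def)
  next
    case (Suc k)
    show ?case
    proof (cases ys)
      case Nil
      with Suc.IH[of "[]" y] show ?thesis
        unfolding funpow_Suc_right by (simp add: step_def enc_list_def)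
    next
      case (Cons h t)
      with Suc.prems Suc.IH[of t "s x h y"] show ?thesis
        unfolding funpow_Suc_right by (simp add: step_def enc_list_def s)
    qed
  qed
  define f where "f x = snd (prod_decode
    (((\<lambda>z. step (prod_encode (x, z))) ^^ xs' x) (prod_encode (xs' x, a' x))))" for x
  have "computable f"
    unfolding f_def
    by (intro computable_compose[OF computable_snd_decode] computable_funpow step computable_prod_encode c)
  moreover have "f (enc x) = enc (fold (s x) (xs x) (a x))" for x
    using iter[of "xs x" "enc (xs x)" x "a x"] length_le_list_encode[of "map enc (xs x)"]
    by (simp add: f_def xs a enc_list_def)
  ultimately show ?thesis by (auto simp: effective_def)
qed

lemma effective_rev [effective_intros]: "effective f \<Longrightarrow> effective (\<lambda>x. rev (f x))"
proof -
  assume "effective f"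
  then have "effective (\<lambda>x. fold (#) (f x) [])" by (intro effective_intros)
  moreover have "fold (#) xs [] = rev xs" for xs :: "'b list" by (simp add: rev_conv_fold)
  ultimately show ?thesis by simp
qed

lemma effective_foldr [effective_intros]:
  assumes "effective xs" "effective a" "effective (\<lambda>p. s (fst p) (fst (snd p)) (snd (snd p)))"
  shows "effective (\<lambda>x. foldr (s x) (xs x) (a x))"
  unfolding foldr_conv_fold using assms by (intro effective_intros)

lemma effective_map [effective_intros]:
  assumes "effective xs" "effective (\<lambda>p. s (fst p) (snd p))"
  shows "effective (\<lambda>x. map (s x) (xs x))"
proof -
  have "effective (\<lambda>x. foldr (\<lambda>a b. s x a # b) (xs x) [])"
    by (intro effective_intros assms effective_compose[OF assms(2), of "\<lambda>p. (fst p, fst (snd p))", simplified])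
  moreover have "foldr (\<lambda>a b. f a # b) ys [] = map f ys" for f :: "'b \<Rightarrow> 'c" and ys by (induction ys) auto
  ultimately show ?thesis by simp
qed

lemma effective_filter [effective_intros]:
  assumes "effective xs" "effective (\<lambda>p. P (fst p) (snd p))"
  shows "effective (\<lambda>x. filter (P x) (xs x))"
proof -
  have "effective (\<lambda>x. foldr (\<lambda>a b. if P x a then a # b else b) (xs x) [])"
    by (intro effective_intros assms effective_compose[OF assms(2), of "\<lambda>p. (fst p, fst (snd p))", simplified])
  moreover have "foldr (\<lambda>a b. if Q a then a # b else b) ys [] = filter Q ys" for Q and ys :: "'b list"
    by (induction ys) auto
  ultimately show ?thesis by simp
qed

lemma effective_append [effective_intros]:
  assumes "effective xs" "effective ys"
  shows "effective (\<lambda>x. xs x @ ys x)"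
proof -
  have "effective (\<lambda>x. foldr (#) (xs x) (ys x))" by (intro effective_intros assms)
  moreover have "foldr (#) as bs = as @ bs" for as bs :: "'b list" by (induction as) auto
  ultimately show ?thesis by simp
qed

lemma effective_concat [effective_intros]:
  assumes "effective xs"
  shows "effective (\<lambda>x. concat (xs x))"
  unfolding concat_conv_foldr by (intro effective_intros assms)

lemma effective_conj [effective_intros]:
  assumes "effective P" "effective Q"
  shows "effective (\<lambda>x. P x \<and> Q x)"
proof -
  have "effective (\<lambda>x. if P x then Q x else False)" by (intro effective_intros assms)
  moreover have "(if a then b else False) = (a \<and> b)" for a b by simp
  ultimately show ?thesis by (simp only:)
qed

lemma effective_not [effective_intros]:
  assumes "effective P"
  shows "effective (\<lambda>x. \<not> P x)"
proof -
  have "effective (\<lambda>x. if P x then False else True)" by (intro effective_intros assms)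
  moreover have "(if a then False else True) = (\<not> a)" for a by simp
  ultimately show ?thesis by (simp only:)
qed

lemma effective_ball [effective_intros]:
  assumes "effective xs" "effective (\<lambda>p. P (fst p) (snd p))"
  shows "effective (\<lambda>x. \<forall>a\<in>set (xs x). P x a)"
proof -
  have "effective (\<lambda>x. foldr (\<lambda>a b. P x a \<and> b) (xs x) True)"
    by (intro effective_intros assms effective_compose[OF assms(2), of "\<lambda>p. (fst p, fst (snd p))", simplified])
  moreover have "foldr (\<lambda>a b. Q a \<and> b) ys True = (\<forall>a\<in>set ys. Q a)" for Q and ys :: "'b list"
    by (induction ys) auto
  ultimately show ?thesis by simp
qed

lemma effective_arith:
  assumes "recursive 2 (\<lambda>xs. h (xs ! 0) (xs ! 1))" "effective f" "effective g"
  shows "effective (\<lambda>x. h (f x) (g x) :: nat)"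
proof -
  obtain f' g' where "computable f'" "computable g'" "\<forall>x. f' (enc x) = f x" "\<forall>x. g' (enc x) = g x"
    using assms(2,3) by (auto simp: effective_def enc_nat_def)
  then show ?thesis
    unfolding effective_def
    by (intro exI[of _ "\<lambda>x. h (f' x) (g' x)"]) (simp add: enc_nat_def computable_compose2[OF assms(1)])
qed

lemmas effective_add [effective_intros] = effective_arith[OF recursive_add]
lemmas effective_diff [effective_intros] = effective_arith[OF recursive_diff]

lemma effective_mult [effective_intros]:
  assumes "effective f" "effective g"
  shows "effective (\<lambda>x. f x * g x :: nat)"
proof -
  have "effective (\<lambda>x. ((\<lambda>y. g x + y) ^^ f x) 0)"
    by (intro effective_intros assms effective_compose[OF assms(2)])
  moreover have "((\<lambda>y. b + y) ^^ a) 0 = a * b" for a b :: nat by (induction a) auto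
  ultimately show ?thesis by simp
qed

lemma effective_Suc [effective_intros]: "effective f \<Longrightarrow> effective (\<lambda>x. Suc (f x))"
  by (rule effective_compose[of Suc]) (simp_all add: effective_iff_computable computable_Suc)

lemma effective_is_zero:
  assumes "effective f"
  shows "effective (\<lambda>x. f x = (0 :: nat))"
proof (rule effective_compose[of "\<lambda>n. n = 0"])
  show "effective (\<lambda>n. n = (0 :: nat))"
    unfolding effective_def enc_nat_def enc_bool_def
    by (intro exI[of _ "\<lambda>n. if n = 0 then 0 else 1"] conjI computable_if_zero computable_const
        computable_id) simp
qed (rule assms)

lemma effective_le [effective_intros]:
  assumes "effective f" "effective g"
  shows "effective (\<lambda>x. f x \<le> (g x :: nat))"
  using effective_is_zero[OF effective_diff[OF assms]] by simp

lemma effective_eq [effective_intros]: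
  assumes "effective f" "effective g"
  shows "effective (\<lambda>x. f x = (g x :: nat))"
  using effective_conj[OF effective_le[OF assms] effective_le[OF assms(2,1)]]
  by (simp add: order_eq_iff)

lemma effective_eq_bool [effective_intros]:
  assumes "effective f" "effective g"
  shows "effective (\<lambda>x. f x = (g x :: bool))"
proof -
  have "effective (\<lambda>x. if f x then g x else \<not> g x)" by (intro effective_intros assms)
  moreover have "(if a then b else \<not> b) = (a = b)" for a b by simp
  ultimately show ?thesis by (simp only:)
qed

lemma effective_length [effective_intros]:
  assumes "effective xs"
  shows "effective (\<lambda>x. length (xs x))"
proof -
  have "effective (\<lambda>x. foldr (\<lambda>_. Suc) (xs x) 0)" by (intro effective_intros assms)
  moreover have "foldr (\<lambda>_. Suc) ys 0 = length ys" for ys :: "'b list" by (induction ys) auto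
  ultimately show ?thesis by simp
qed

text \<open>Data that depend on the group only, such as the numbers of the generators or a word for each of
  them, enter an algorithm as a finite table.\<close>

lemma effective_finite_table:
  assumes "finite S"
  shows "effective (\<lambda>n :: nat. if n \<in> S then f n else c)"
  using assms
proof induction
  case empty
  show ?case by (simp add: effective_const)
next
  case (insert a S)
  have "effective (\<lambda>n. if n = a then f a else if n \<in> S then f n else c)"
    by (intro effective_intros insert.IH)
  also have "(\<lambda>n. if n = a then f a else if n \<in> S then f n else c) =
      (\<lambda>n. if n \<in> insert a S then f n else c)"
    by auto
  finally show ?case .
qed

lemma decidable_iff_effective: "decidable A \<longleftrightarrow> effective (\<lambda>n. n \<in> A)"
proof
  assume "decidable A"
  then have "effective (\<lambda>n. if n \<in> A then 1 else 0 :: nat)"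
    by (simp add: decidable_def effective_iff_computable)
  then have "effective (\<lambda>n. \<not> (if n \<in> A then 1 else 0 :: nat) = 0)"
    by (intro effective_not effective_is_zero)
  moreover have "(\<not> (if b then 1 else 0 :: nat) = 0) = b" for b by simp
  ultimately show "effective (\<lambda>n. n \<in> A)" by (simp only:)
next
  assume "effective (\<lambda>n. n \<in> A)"
  then have "effective (\<lambda>n. if n \<in> A then 1 else 0 :: nat)" by (intro effective_intros)
  then show "decidable A" by (simp add: decidable_def effective_iff_computable)
qed

text \<open>Decoding is the identity on codes.\<close>

lemma effective_list_decode: "effective list_decode"
  unfolding effective_def by (intro exI[of _ "\<lambda>x. x"]) (simp add: computable_id enc_list_def enc_nat_def[abs_def])

lemma effective_prod_decode: "effective prod_decode"
  unfolding effective_def by (intro exI[of _ "\<lambda>x. x"]) (simp add: computable_id enc_prod_def enc_nat_def)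

lemma effective_enc: "effective enc"
  unfolding effective_def by (intro exI[of _ "\<lambda>x. x"]) (simp add: computable_id enc_nat_def)

text \<open>Unbounded search: a total relation that can be decided can be uniformized.\<close>

lemma effective_search:
  fixes P :: "nat \<Rightarrow> nat \<Rightarrow> bool"
  assumes "effective (\<lambda>p. P (fst p) (snd p))" "\<And>x. \<exists>n. P x n"
  obtains g where "effective g" "\<And>x. P x (g x)"
proof -
  obtain h where h: "computable h" "h (enc p) = enc (P (fst p) (snd p))" for p
    using assms(1) by (auto simp: effective_def)
  have P: "P x n \<longleftrightarrow> h (prod_encode (x, n)) = 0" for x n
    using h(2)[of "(x, n)"] by (simp add: enc_prod_def enc_nat_def enc_bool_def)
  let ?g = "\<lambda>x. LEAST n. h (prod_encode (x, n)) = 0"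
  have "effective ?g"
    unfolding effective_iff_computable
    by (rule computable_Least[OF h(1)]) (use assms(2) P in blast)
  moreover have "P x (?g x)" for x
    unfolding P by (rule LeastI_ex) (use assms(2) P in blast)
  ultimately show ?thesis by (rule that)
qed

section \<open>Evaluation of words\<close>

definition word_inverse :: "'a word \<Rightarrow> 'a word" where
  "word_inverse w = rev (map inv_letter w)"

lemma words_append: "u @ v \<in> words X \<longleftrightarrow> u \<in> words X \<and> v \<in> words X"
  by (auto simp: words_def)

lemma words_Cons: "l # w \<in> words X \<longleftrightarrow> fst l \<in> X \<and> w \<in> words X"
  by (cases l) (auto simp: words_def)

lemma words_Nil: "[] \<in> words X"
  by (simp add: words_def)

lemma words_iff: "w \<in> words X \<longleftrightarrow> (\<forall>l\<in>set w. fst l \<in> X)"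
  by (induction w) (auto simp: words_Nil words_Cons)

lemma word_inverse_words: "w \<in> words X \<Longrightarrow> word_inverse w \<in> words X"
  by (auto simp: words_iff word_inverse_def inv_letter_def)

lemmas words_simps = words_append words_Cons words_Nil word_inverse_words

context group
begin

lemma word_eval_Nil: "word_eval G [] = \<one>"
  by (simp add: word_eval_def)

lemma word_eval_generator: "x \<in> carrier G \<Longrightarrow> word_eval G [(x, s)] = (if s then x else inv x)"
  by (simp add: word_eval_def)

lemma word_eval_Cons:
  assumes "fst l \<in> carrier G"
  shows "word_eval G (l # w) = word_eval G [l] \<otimes> word_eval G w"
  using assms by (cases l) (simp add: word_eval_def)

lemma word_eval_closed: "X \<subseteq> carrier G \<Longrightarrow> w \<in> words X \<Longrightarrow> word_eval G w \<in> carrier G"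
proof (induction w)
  case (Cons l w)
  then have "word_eval G [l] \<in> carrier G" "fst l \<in> carrier G"
    by (cases l; auto simp: words_Cons word_eval_generator)+
  with Cons show ?case by (subst word_eval_Cons) (auto simp: words_Cons)
qed (simp add: word_eval_Nil)

lemma word_eval_append:
  assumes "X \<subseteq> carrier G" "u \<in> words X" "v \<in> words X"
  shows "word_eval G (u @ v) = word_eval G u \<otimes> word_eval G v"
  using assms(2)
proof (induction u)
  case Nil
  show ?case using word_eval_closed[OF assms(1,3)] by (simp add: word_eval_Nil)
next
  case (Cons l u)
  then have l: "fst l \<in> carrier G" "[l] \<in> words X" and u: "u \<in> words X"
    using assms(1) by (auto simp: words_simps)
  have "word_eval G ((l # u) @ v) = word_eval G [l] \<otimes> word_eval G (u @ v)"
    using word_eval_Cons[OF l(1), of "u @ v"] by simp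
  also have "\<dots> = word_eval G [l] \<otimes> (word_eval G u \<otimes> word_eval G v)"
    using Cons.IH u by simp
  also have "\<dots> = word_eval G (l # u) \<otimes> word_eval G v"
    using l u by (simp add: word_eval_Cons[OF l(1), of u] m_assoc word_eval_closed[OF assms(1)] assms(3))
  finally show ?case .
qed

text \<open>Reduction is evaluation in the free group, so this is the homomorphism property applied letter by
  letter.\<close>

lemma word_eval_reduce:
  assumes "X \<subseteq> carrier G" "w \<in> words X"
  shows "word_eval G (reduce w) = word_eval G w"
  using assms(2)
proof (induction w)
  case (Cons l w)
  then have l: "fst l \<in> carrier G" "[l] \<in> words X" and w: "w \<in> words X"
    using assms(1) by (auto simp: words_simps)
  have "reduced [l]" by (simp add: reduced_def)
  then have *: "[l] \<in> carrier (free_group X)" "reduce w \<in> carrier (free_group X)"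
    using l w by (auto simp: free_group_def reduced_reduce words_reduce)
  have "reduce (l # w) = [l] \<otimes>\<^bsub>free_group X\<^esub> reduce w"
    using reduce_append_reduce_right[of "[l]" w] by (simp add: free_group_def)
  then show ?case
    using hom_mult[OF word_eval_hom[OF assms(1)] *] Cons.IH[OF w] word_eval_Cons[OF l(1), of w] by simp
qed (simp add: reduce_def)

lemma word_eval_inverse:
  assumes "X \<subseteq> carrier G" "w \<in> words X"
  shows "word_eval G (word_inverse w) = inv (word_eval G w)"
proof -
  have "word_eval G (word_inverse w @ w) = word_eval G (reduce (word_inverse w @ w))"
    using assms by (intro word_eval_reduce[symmetric]) (auto simp: words_simps)
  also have "\<dots> = \<one>"
    by (simp add: word_inverse_def reduce_inverse word_eval_Nil)
  finally show ?thesis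
    using assms by (intro inv_equality[symmetric])
      (auto simp: word_eval_append word_inverse_words word_eval_closed)
qed

lemma generate_eq_word_eval:
  assumes "X \<subseteq> carrier G"
  shows "generate G X = word_eval G ` words X"
proof (intro equalityI subsetI)
  fix g assume "g \<in> generate G X"
  then show "g \<in> word_eval G ` words X"
  proof induction
    case one
    show ?case using word_eval_Nil words_Nil by (metis imageI)
  next
    case (incl x)
    then have "word_eval G [(x, True)] = x" "[(x, True)] \<in> words X"
      using assms by (auto simp: word_eval_generator words_simps)
    then show ?case by (metis imageI)
  next
    case (inv x)
    then have "word_eval G [(x, False)] = inv x" "[(x, False)] \<in> words X"
      using assms by (auto simp: word_eval_generator words_simps)
    then show ?case by (metis imageI)
  next
    case (eng g h)
    then obtain u v where "u \<in> words X" "v \<in> words X" "g = word_eval G u" "h = word_eval G v" by blast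
    then show ?case using word_eval_append[OF assms] words_append by (metis imageI)
  qed
next
  fix g assume "g \<in> word_eval G ` words X"
  then obtain w where w: "w \<in> words X" "g = word_eval G w" by blast
  have "word_eval G w \<in> generate G X" using w(1)
  proof (induction w)
    case (Cons l w)
    then have l: "fst l \<in> X" "fst l \<in> carrier G" using assms by (auto simp: words_simps)
    then have "word_eval G [l] \<in> generate G X"
      by (cases l) (auto simp: word_eval_generator intro: generate.incl generate.inv)
    with Cons show ?case
      using word_eval_Cons[OF l(2), of w] by (auto simp: words_simps intro: generate.eng)
  qed (simp add: word_eval_Nil generate.one)
  with w show "g \<in> generate G X" by simp
qed

section \<open>Sets that are almost invariant under translations\<close>

lemma l_coset_eq_image: "x <# F = (\<otimes>) x ` F"
  by (auto simp: l_coset_def)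

lemma left_cancel:
  assumes "x \<in> carrier G" "y \<in> carrier G" "z \<in> carrier G"
  shows "x \<otimes> y = x \<otimes> z \<longleftrightarrow> y = z"
  using Units_l_cancel[of x y z] assms by simp

lemma card_l_coset: "x \<in> carrier G \<Longrightarrow> F \<subseteq> carrier G \<Longrightarrow> card (x <# F) = card F"
  unfolding l_coset_eq_image by (intro card_image inj_onI) (auto simp: left_cancel subset_iff)

lemma inv_mult_cancel: "x \<in> carrier G \<Longrightarrow> y \<in> carrier G \<Longrightarrow> inv x \<otimes> (x \<otimes> y) = y"
  by (simp flip: m_assoc)

lemma mult_inv_cancel: "x \<in> carrier G \<Longrightarrow> y \<in> carrier G \<Longrightarrow> x \<otimes> (inv x \<otimes> y) = y"
  by (simp flip: m_assoc)

lemma card_Diff_inv_l_coset: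
  assumes "finite F" "F \<subseteq> carrier G" "x \<in> carrier G"
  shows "card (F - (inv x <# F)) = card (F - (x <# F))"
proof -
  have fin: "finite (x <# F)" using assms(1) by (simp add: l_coset_eq_image)
  have "x <# (F - (inv x <# F)) = (x <# F) - F"
  proof (intro equalityI subsetI)
    fix y assume "y \<in> x <# (F - (inv x <# F))"
    then obtain f where f: "f \<in> F" "f \<notin> inv x <# F" "y = x \<otimes> f" by (auto simp: l_coset_eq_image)
    have "f \<in> carrier G" using f(1) assms(2) by blast
    then have "f = inv x \<otimes> y" unfolding f(3) using assms(3) by (simp add: inv_mult_cancel)
    then have "y \<notin> F" using f(2) unfolding l_coset_eq_image by blast
    with f show "y \<in> (x <# F) - F" by (auto simp: l_coset_eq_image)
  next
    fix y assume "y \<in> (x <# F) - F"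
    then obtain f where f: "f \<in> F" "y = x \<otimes> f" "y \<notin> F" by (auto simp: l_coset_eq_image)
    have "f \<notin> inv x <# F"
    proof
      assume "f \<in> inv x <# F"
      then obtain f' where "f' \<in> F" "f = inv x \<otimes> f'" by (auto simp: l_coset_eq_image)
      moreover from this have "f' \<in> carrier G" using assms(2) by auto
      ultimately show False using f assms(3) by (simp add: mult_inv_cancel)
    qed
    with f show "y \<in> x <# (F - (inv x <# F))" by (auto simp: l_coset_eq_image)
  qed
  then have "card (F - (inv x <# F)) = card ((x <# F) - F)"
    using card_l_coset[OF assms(3), of "F - (inv x <# F)"] assms(2) by (simp add: subset_iff)
  also have "\<dots> = card (F - (x <# F))"
    using card_l_coset[OF assms(3,2)] card_Diff_subset_Int[of "x <# F" F]
      card_Diff_subset_Int[of F "x <# F"] fin assms(1) by (simp add: Int_commute)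
  finally show ?thesis .
qed

lemma card_Diff_l_coset_mult:
  assumes "finite F" "F \<subseteq> carrier G" "g \<in> carrier G" "h \<in> carrier G"
  shows "card (F - ((g \<otimes> h) <# F)) \<le> card (F - (g <# F)) + card (F - (h <# F))"
proof -
  have "F - ((g \<otimes> h) <# F) \<subseteq> (F - (g <# F)) \<union> (g <# (F - (h <# F)))"
  proof
    fix y assume y: "y \<in> F - ((g \<otimes> h) <# F)"
    show "y \<in> (F - (g <# F)) \<union> (g <# (F - (h <# F)))"
    proof (cases "y \<in> g <# F")
      case True
      then obtain f where f: "f \<in> F" "y = g \<otimes> f" by (auto simp: l_coset_eq_image)
      have "f \<notin> h <# F"
      proof
        assume "f \<in> h <# F"
        then obtain f' where "f' \<in> F" "f = h \<otimes> f'" by (auto simp: l_coset_eq_image)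
        moreover from this have "f' \<in> carrier G" using assms(2) by auto
        ultimately have "y = g \<otimes> h \<otimes> f'" "f' \<in> F"
          using f assms(3,4) by (simp_all add: m_assoc)
        then show False using y by (auto simp: l_coset_eq_image)
      qed
      with f show ?thesis by (auto simp: l_coset_eq_image)
    qed (use y in auto)
  qed
  then have "card (F - ((g \<otimes> h) <# F)) \<le> card ((F - (g <# F)) \<union> (g <# (F - (h <# F))))"
    using assms(1) by (intro card_mono) (auto simp: l_coset_eq_image)
  also have "\<dots> \<le> card (F - (g <# F)) + card (g <# (F - (h <# F)))" by (rule card_Un_le)
  also have "card (g <# (F - (h <# F))) = card (F - (h <# F))"
    using assms by (intro card_l_coset) auto
  finally show ?thesis by simp
qed

text \<open>Almost invariance under a generating set passes to every group element, with a loss that does not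
  depend on the set \<open>F\<close>: the defects of a product add up, and an element has the same defect as its
  inverse. Hence the choice of the generating set does not matter for amenability.\<close>

lemma card_Diff_l_coset_generate:
  assumes "Y \<subseteq> carrier G" "g \<in> generate G Y"
  shows "\<exists>l :: nat. \<forall>F n. finite F \<and> F \<subseteq> carrier G \<and> (\<forall>y\<in>Y. n * card (F - (y <# F)) \<le> card F) \<longrightarrow>
    n * card (F - (g <# F)) \<le> l * card F"
  using assms(2)
proof induction
  case one
  have "F - (\<one> <# F) = {}" if "F \<subseteq> carrier G" for F
    using that by (force simp: l_coset_eq_image)
  then show ?case by (intro exI[of _ 0]) auto
next
  case (incl y)
  then show ?case by (intro exI[of _ 1]) auto
next
  case (inv y)
  then have "y \<in> carrier G" using assms(1) by auto
  with inv show ?case by (intro exI[of _ 1]) (auto simp: card_Diff_inv_l_coset)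
next
  case (eng g h)
  then obtain l m where
    l: "\<And>F n. finite F \<and> F \<subseteq> carrier G \<and> (\<forall>y\<in>Y. n * card (F - (y <# F)) \<le> card F) \<Longrightarrow>
      n * card (F - (g <# F)) \<le> l * card F" and
    m: "\<And>F n. finite F \<and> F \<subseteq> carrier G \<and> (\<forall>y\<in>Y. n * card (F - (y <# F)) \<le> card F) \<Longrightarrow>
      n * card (F - (h <# F)) \<le> m * card F"
    by meson
  have gh: "g \<in> carrier G" "h \<in> carrier G"
    using eng.hyps generate_in_carrier[OF assms(1)] by auto
  show ?case
  proof (intro exI[of _ "l + m"] allI impI)
    fix F and n :: nat
    assume F: "finite F \<and> F \<subseteq> carrier G \<and> (\<forall>y\<in>Y. n * card (F - (y <# F)) \<le> card F)"
    have "n * card (F - ((g \<otimes> h) <# F)) \<le> n * (card (F - (g <# F)) + card (F - (h <# F)))"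
      using F gh by (intro mult_le_mono2 card_Diff_l_coset_mult) auto
    with l[OF F] m[OF F] show "n * card (F - ((g \<otimes> h) <# F)) \<le> (l + m) * card F"
      by (simp add: algebra_simps)
  qed
qed

lemma folner_set_iff:
  assumes "n \<ge> 1"
  shows "folner_set G X n F \<longleftrightarrow> finite F \<and> F \<noteq> {} \<and> F \<subseteq> carrier G \<and>
    (\<forall>x\<in>X. n * card (F - (x <# F)) \<le> card F)"
proof -
  have "real a / real b \<le> 1 / real n \<longleftrightarrow> n * a \<le> b" if "b > 0" for a b
    using that assms by (simp add: field_simps flip: of_nat_mult)
  then show ?thesis unfolding folner_set_def by (metis card_gt_0_iff)
qed

text \<open>Without denominators the inequality makes sense for \<open>n = 0\<close> too, and is trivial there; the search has to
  end for this input as well.\<close>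

lemma amenable_finite_subset:
  assumes "amenable G" "finite Z" "Z \<subseteq> carrier G"
  obtains F where "finite F" "F \<noteq> {}" "F \<subseteq> carrier G" "\<And>z. z \<in> Z \<Longrightarrow> n * card (F - (z <# F)) \<le> card F"
proof -
  obtain Y where Y: "generating_set G Y" "amenable_wrt G Y"
    using assms(1) by (auto simp: amenable_def)
  then have Y': "Y \<subseteq> carrier G" "generate G Y = carrier G" by (auto simp: generating_set_def)
  have "\<forall>z\<in>Z. \<exists>l :: nat. \<forall>F n. finite F \<and> F \<subseteq> carrier G \<and> (\<forall>y\<in>Y. n * card (F - (y <# F)) \<le> card F) \<longrightarrow>
    n * card (F - (z <# F)) \<le> l * card F"
    using card_Diff_l_coset_generate[OF Y'(1)] Y'(2) assms(3) by blast
  then obtain l :: "'a \<Rightarrow> nat" where l: "\<And>z F n. z \<in> Z \<Longrightarrow> finite F \<Longrightarrow> F \<subseteq> carrier G \<Longrightarrow>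
      \<forall>y\<in>Y. n * card (F - (y <# F)) \<le> card F \<Longrightarrow> n * card (F - (z <# F)) \<le> l z * card F"
    by metis
  \<comment> \<open>The factor \<open>L\<close> absorbs the losses of all \<open>z\<close>, and \<open>Suc n\<close> keeps the index positive.\<close>
  define L where "L = Suc (sum l Z)"
  have "1 \<le> Suc n * L" by (simp add: L_def)
  with Y(2) obtain F where "folner_set G Y (Suc n * L) F" unfolding amenable_wrt_def by blast
  then have F: "finite F" "F \<noteq> {}" "F \<subseteq> carrier G" "\<forall>y\<in>Y. Suc n * L * card (F - (y <# F)) \<le> card F"
    using folner_set_iff[OF \<open>1 \<le> Suc n * L\<close>] by auto
  show ?thesis
  proof (rule that[OF F(1-3)])
    fix z assume z: "z \<in> Z"
    have "L * (Suc n * card (F - (z <# F))) \<le> l z * card F"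
      using l[OF z F(1,3,4)] by (simp add: algebra_simps)
    also have "\<dots> \<le> L * card F"
      using member_le_sum[of z Z l] z assms(2) by (intro mult_le_mono1) (auto simp: L_def)
    finally have "Suc n * card (F - (z <# F)) \<le> card F" by (simp add: L_def del: mult_Suc)
    then show "n * card (F - (z <# F)) \<le> card F" by simp
  qed
qed

text \<open>The set \<open>B\<close> is a union of progressions \<open>c, s c, \<dots>, s\<^sup>M\<^sup>-\<^sup>1 c\<close>. A point of \<open>B\<close> outside \<open>s B\<close> can only be
  the first point of such a progression, and progressions that start at different points of this
  kind are disjoint: if they met, one of the two starting points would be a later point of the other
  progression and would lie in \<open>s B\<close>. So each of these points accounts for \<open>M\<close> points of \<open>B\<close> of its
  own. The argument is the same for every order of \<open>s\<close> and for all coincidences between the products,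
  and this is what makes it possible to write down almost invariant sets without deciding equality.\<close>

lemma card_Diff_l_coset_progressions:
  assumes "s \<in> carrier G" "C \<subseteq> carrier G" "finite B" and B: "B = (\<lambda>(k, c). s [^] k \<otimes> c) ` ({..<M :: nat} \<times> C)"
  shows "M * card (B - (s <# B)) \<le> card B"
proof -
  let ?D = "B - (s <# B)"
  have BG: "B \<subseteq> carrier G" using assms(1,2) by (auto simp: B)
  have pow: "s [^] Suc k \<otimes> c = s \<otimes> (s [^] k \<otimes> c)" if "c \<in> carrier G" for k :: nat and c
    using that assms(1) nat_pow_Suc2[of s k] by (simp add: m_assoc del: nat_pow_Suc)
  \<comment> \<open>A point outside \<open>s B\<close> has exponent 0 in every representation.\<close>
  have start: "s [^] j \<otimes> y \<in> B" if "y \<in> ?D" "j < M" for y and j :: nat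
  proof -
    have "y \<in> B" using that(1) by blast
    then obtain k c where k: "k < M" "c \<in> C" "y = s [^] k \<otimes> c" by (auto simp: B)
    have "k = 0"
    proof (rule ccontr)
      assume "k \<noteq> 0"
      then obtain i where i: "k = Suc i" using not0_implies_Suc by blast
      then have "s [^] i \<otimes> c \<in> B" using k by (auto simp: B)
      then show False using that(1) k i pow[of c i] assms(2) by (auto simp: l_coset_eq_image)
    qed
    then have "y = c" using k(2,3) assms(2) by auto
    with k(2) that(2) show ?thesis by (auto simp: B)
  qed
  have disjoint: "i \<ge> j" if "y \<in> ?D" "y' \<in> ?D" "j < M" and eq: "s [^] i \<otimes> y = s [^] j \<otimes> y'" for i j :: nat and y y'
  proof (rule ccontr)
    assume "\<not> i \<ge> j"
    then obtain m where m: "j = i + Suc m" using less_imp_Suc_add[of i j] by auto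
    have y: "y \<in> carrier G" "y' \<in> carrier G" using that BG by auto
    have "s [^] i \<otimes> y = s [^] i \<otimes> (s [^] Suc m \<otimes> y')"
      using eq y assms(1) by (simp add: m nat_pow_mult[symmetric] m_assoc[symmetric] del: nat_pow_Suc)
    then have "y = s \<otimes> (s [^] m \<otimes> y')"
      using y assms(1) pow[OF y(2), of m] left_cancel[of "s [^] i" y "s [^] Suc m \<otimes> y'"] by auto
    moreover have "s [^] m \<otimes> y' \<in> B" using start[OF that(2), of m] that(3) m by simp
    ultimately show False using that(1) by (auto simp: l_coset_eq_image)
  qed
  have "inj_on (\<lambda>(j, y). s [^] j \<otimes> y) ({..<M} \<times> ?D)"
  proof (rule inj_onI)
    fix p q :: "nat \<times> 'a"
    assume "p \<in> {..<M} \<times> ?D" "q \<in> {..<M} \<times> ?D"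
      and eq: "(\<lambda>(j, y). s [^] j \<otimes> y) p = (\<lambda>(j, y). s [^] j \<otimes> y) q"
    then obtain i y j y' where pq: "p = (i, y)" "q = (j, y')"
      and *: "y \<in> ?D" "y' \<in> ?D" "i < M" "j < M" by blast
    with eq have **: "s [^] i \<otimes> y = s [^] j \<otimes> y'" by simp
    have "i = j" using disjoint[OF *(1,2,4) **] disjoint[OF *(2,1,3) **[symmetric]] by simp
    moreover have "y \<in> carrier G" "y' \<in> carrier G" using * BG by auto
    ultimately show "p = q" using ** assms(1) left_cancel[of "s [^] j" y y'] by (auto simp: pq)
  qed
  then have "card ((\<lambda>(j, y). s [^] j \<otimes> y) ` ({..<M} \<times> ?D)) = M * card ?D"
    by (simp add: card_image card_cartesian_product)
  moreover have "(\<lambda>(j, y). s [^] j \<otimes> y) ` ({..<M} \<times> ?D) \<subseteq> B" using start by auto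
  ultimately show ?thesis using card_mono[OF assms(3)] by metis
qed

end

text \<open>The set of all products of powers, with exponents below \<open>M\<close>, of the listed elements. Different
  exponents may give the same element.\<close>

primrec power_box :: "('a, 'b) monoid_scheme \<Rightarrow> nat \<Rightarrow> 'a list \<Rightarrow> 'a set" where
  "power_box G M [] = {\<one>\<^bsub>G\<^esub>}"
| "power_box G M (s # S) = (\<lambda>(k, b). s [^]\<^bsub>G\<^esub> k \<otimes>\<^bsub>G\<^esub> b) ` ({..<M} \<times> power_box G M S)"

context group
begin

lemma finite_power_box: "finite (power_box G M S)"
  by (induction S) auto

lemma power_box_nonempty: "M \<ge> 1 \<Longrightarrow> power_box G M S \<noteq> {}"
  by (induction S) (auto simp: lessThan_empty_iff)

lemma power_box_subgroup:
  assumes "subgroup K G" "set S \<subseteq> K"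
  shows "power_box G M S \<subseteq> K"
proof -
  interpret K: subgroup K G by fact
  have "s [^] k \<in> K" if "s \<in> K" for s and k :: nat
    using that by (induction k) auto
  with assms(2) show ?thesis by (induction S) auto
qed

text \<open>When the listed elements commute, the powers of any one of them can be moved to the front, which
  displays the box as a union of progressions of length \<open>M\<close> in that direction.\<close>

lemma card_Diff_l_coset_power_box:
  assumes K: "subgroup K G" "\<And>a b. a \<in> K \<Longrightarrow> b \<in> K \<Longrightarrow> a \<otimes> b = b \<otimes> a"
    and S: "set S \<subseteq> K" "s \<in> set S"
  shows "M * card (power_box G M S - (s <# power_box G M S)) \<le> card (power_box G M S)"
proof -
  interpret K: subgroup K G by fact
  have pow: "a [^] k \<in> K" if "a \<in> K" for a and k :: nat using that by (induction k) auto
  have "\<exists>C \<subseteq> K. power_box G M S = (\<lambda>(k, c). s [^] k \<otimes> c) ` ({..<M} \<times> C)"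
    using S
  proof (induction S)
    case (Cons a S)
    show ?case
    proof (cases "s = a")
      case True
      then show ?thesis using power_box_subgroup[OF K(1), of S M] Cons.prems by auto
    next
      case False
      with Cons obtain C where C: "C \<subseteq> K" "power_box G M S = (\<lambda>(k, c). s [^] k \<otimes> c) ` ({..<M} \<times> C)"
        by auto
      have a: "a \<in> K" and s: "s \<in> K" using Cons.prems by auto
      have swap: "a [^] j \<otimes> (s [^] k \<otimes> c) = s [^] k \<otimes> (a [^] j \<otimes> c)" if "c \<in> K" for j k :: nat and c
        using K(2)[OF pow[OF a] pow[OF s], of j k] pow[OF a, of j] pow[OF s, of k] that
        by (simp add: m_assoc[symmetric])
      let ?C = "(\<lambda>(j, c). a [^] j \<otimes> c) ` ({..<M} \<times> C)"
      have "?C \<subseteq> K" using C(1) pow[OF a] by auto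
      moreover have "power_box G M (a # S) = (\<lambda>(k, c). s [^] k \<otimes> c) ` ({..<M} \<times> ?C)"
      proof (intro equalityI subsetI)
        fix x assume "x \<in> power_box G M (a # S)"
        then obtain j k c where "j < M" "k < M" "c \<in> C" "x = a [^] j \<otimes> (s [^] k \<otimes> c)"
          by (auto simp: C)
        then show "x \<in> (\<lambda>(k, c). s [^] k \<otimes> c) ` ({..<M} \<times> ?C)"
          using swap[of c j k] C(1) by (intro image_eqI[of _ _ "(k, a [^] j \<otimes> c)"]) auto
      next
        fix x assume "x \<in> (\<lambda>(k, c). s [^] k \<otimes> c) ` ({..<M} \<times> ?C)"
        then obtain j k c where "j < M" "k < M" "c \<in> C" "x = s [^] k \<otimes> (a [^] j \<otimes> c)" by auto
        then show "x \<in> power_box G M (a # S)"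
          using swap[of c j k] C(1) unfolding power_box.simps C(2)
          by (intro image_eqI[of _ _ "(j, s [^] k \<otimes> c)"]) auto
      qed
      ultimately show ?thesis by blast
    qed
  qed simp
  then obtain C where "C \<subseteq> K" "power_box G M S = (\<lambda>(k, c). s [^] k \<otimes> c) ` ({..<M} \<times> C)" by blast
  moreover have "K \<subseteq> carrier G" by (rule K.subset)
  ultimately show ?thesis
    using S by (intro card_Diff_l_coset_progressions[OF _ _ finite_power_box]) auto
qed

end

context group_hom
begin

text \<open>Let \<open>T\<close> represent an almost invariant set of the quotient. For a slice \<open>u A\<close> of the product
  set, either no element of \<open>T\<close> is taken into the coset of \<open>u\<close> by \<open>x\<close>, which happens rarely by almost
  invariance in the quotient, or \<open>x t = u s\<close> with \<open>t\<close> in \<open>T\<close> and \<open>s\<close> in the kernel, and the image \<open>u s A\<close> differs little from the slice \<open>u A\<close> when \<open>A\<close> is almost invariant under the finitely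
  many elements \<open>s\<close> that occur. Each of the two contributions is at most half of the allowed defect.\<close>

lemma card_Diff_l_coset_transversal:
  assumes T: "finite T" "T \<subseteq> carrier G" "inj_on h T"
    and A: "finite A" "A \<subseteq> kernel G H h"
    and x: "x \<in> carrier G"
    and quotient: "2 * n * card {u \<in> T. \<forall>t\<in>T. inv u \<otimes> (x \<otimes> t) \<notin> kernel G H h} \<le> card T"
    and kern: "\<And>t u. t \<in> T \<Longrightarrow> u \<in> T \<Longrightarrow> inv u \<otimes> (x \<otimes> t) \<in> kernel G H h \<Longrightarrow>
      2 * n * card (A - ((inv u \<otimes> (x \<otimes> t)) <# A)) \<le> card A"
  shows "n * card ((T <#> A) - (x <# (T <#> A))) \<le> card (T <#> A)"
proof -
  let ?K = "kernel G H h" and ?E = "T <#> A"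
  let ?U = "{u \<in> T. \<forall>t\<in>T. inv u \<otimes> (x \<otimes> t) \<notin> ?K}"
  have AG: "A \<subseteq> carrier G" using A(2) by (auto simp: kernel_def)
  have hA: "h a = \<one>\<^bsub>H\<^esub>" if "a \<in> A" for a using that A(2) by (auto simp: kernel_def)
  have E: "?E = (\<lambda>(t, a). t \<otimes> a) ` (T \<times> A)" by (auto simp: set_mult_def)
  have "inj_on (\<lambda>(t, a). t \<otimes> a) (T \<times> A)"
  proof (rule inj_onI, clarify)
    fix t a t' a' assume *: "t \<in> T" "a \<in> A" "t' \<in> T" "a' \<in> A" "t \<otimes> a = t' \<otimes> a'"
    then have G: "t \<in> carrier G" "a \<in> carrier G" "t' \<in> carrier G" "a' \<in> carrier G" using T(2) AG by auto
    then have "h t = h t'" using arg_cong[OF *(5), of h] hA[OF *(2)] hA[OF *(4)] by simp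
    then have "t = t'" using T(3) * by (auto dest: inj_onD)
    with * G show "t = t' \<and> a = a'" using G.left_cancel[of t a a'] by auto
  qed
  then have card_E: "card ?E = card T * card A" unfolding E by (simp add: card_image card_cartesian_product)
  define s where "s u = inv u \<otimes> (x \<otimes> (SOME t. t \<in> T \<and> inv u \<otimes> (x \<otimes> t) \<in> ?K))" for u
  have s: "\<exists>t\<in>T. s u = inv u \<otimes> (x \<otimes> t) \<and> inv u \<otimes> (x \<otimes> t) \<in> ?K" if "u \<in> T - ?U" for u
  proof -
    have "\<exists>t. t \<in> T \<and> inv u \<otimes> (x \<otimes> t) \<in> ?K" using that by auto
    from someI_ex[OF this] show ?thesis unfolding s_def by blast
  qed
  \<comment> \<open>A slice \<open>u A\<close> is lost entirely if its coset is not hit, and otherwise at most up to \<open>u (A - s A)\<close>.\<close>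
  have sub: "?E - (x <# ?E) \<subseteq> (\<Union>u\<in>?U. u <# A) \<union> (\<Union>u\<in>T - ?U. u <# (A - (s u <# A)))"
  proof
    fix y assume y: "y \<in> ?E - (x <# ?E)"
    then obtain u a where u: "u \<in> T" "a \<in> A" "y = u \<otimes> a" by (auto simp: E)
    show "y \<in> (\<Union>u\<in>?U. u <# A) \<union> (\<Union>u\<in>T - ?U. u <# (A - (s u <# A)))"
    proof (cases "u \<in> ?U")
      case True
      have "y \<in> u <# A" using u by (auto simp: G.l_coset_eq_image)
      with True show ?thesis by blast
    next
      case False
      with u obtain t where t: "t \<in> T" "s u = inv u \<otimes> (x \<otimes> t)" using s[of u] by auto
      have "a \<notin> s u <# A"
      proof
        assume "a \<in> s u <# A"
        then obtain b where b: "b \<in> A" "a = s u \<otimes> b" by (auto simp: G.l_coset_eq_image)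
        have G: "u \<in> carrier G" "t \<in> carrier G" "b \<in> carrier G" using u t b T(2) AG by auto
        have "y = x \<otimes> (t \<otimes> b)"
          using G x unfolding u(3) b(2) t(2) by (simp add: G.m_assoc G.mult_inv_cancel)
        then show False using y t b by (auto simp: E G.l_coset_eq_image)
      qed
      with u False show ?thesis by (auto simp: G.l_coset_eq_image)
    qed
  qed
  have fin: "finite (u <# B)" if "B \<subseteq> A" for u B
    using that A(1) finite_subset by (auto simp: G.l_coset_eq_image)
  have "card (?E - (x <# ?E)) \<le> card ((\<Union>u\<in>?U. u <# A) \<union> (\<Union>u\<in>T - ?U. u <# (A - (s u <# A))))"
    using T(1) fin by (intro card_mono sub) auto
  also have "\<dots> \<le> card (\<Union>u\<in>?U. u <# A) + card (\<Union>u\<in>T - ?U. u <# (A - (s u <# A)))"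
    by (rule card_Un_le)
  also have "card (\<Union>u\<in>?U. u <# A) \<le> (\<Sum>u\<in>?U. card (u <# A))"
    using T(1) by (intro card_UN_le) auto
  also have "\<dots> = (\<Sum>u\<in>?U. card A)"
    using T(2) AG by (intro sum.cong G.card_l_coset) auto
  also have "card (\<Union>u\<in>T - ?U. u <# (A - (s u <# A))) \<le> (\<Sum>u\<in>T - ?U. card (u <# (A - (s u <# A))))"
    using T(1) by (intro card_UN_le) auto
  also have "\<dots> = (\<Sum>u\<in>T - ?U. card (A - (s u <# A)))"
    using T(2) AG by (intro sum.cong G.card_l_coset) auto
  finally have le: "card (?E - (x <# ?E)) \<le> card ?U * card A + (\<Sum>u\<in>T - ?U. card (A - (s u <# A)))"
    by simp
  have "2 * n * (\<Sum>u\<in>T - ?U. card (A - (s u <# A))) = (\<Sum>u\<in>T - ?U. 2 * n * card (A - (s u <# A)))"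
    by (simp add: sum_distrib_left)
  also have "\<dots> \<le> (\<Sum>u\<in>T - ?U. card A)"
    using s kern by (intro sum_mono) fastforce
  also have "\<dots> \<le> (\<Sum>u\<in>T. card A)"
    using T(1) by (intro sum_mono2) auto
  finally have K: "2 * n * (\<Sum>u\<in>T - ?U. card (A - (s u <# A))) \<le> card T * card A" by simp
  have "2 * n * (card ?U * card A) \<le> card T * card A"
    using mult_le_mono1[OF quotient, of "card A"] by (simp add: mult.assoc del: mult_le_cancel2)
  moreover have "2 * n * card (?E - (x <# ?E)) \<le>
      2 * n * (card ?U * card A) + 2 * n * (\<Sum>u\<in>T - ?U. card (A - (s u <# A)))"
    using mult_le_mono2[OF le, of "2 * n"] by (simp only: distrib_left)
  ultimately have "2 * n * card (?E - (x <# ?E)) \<le> 2 * (card T * card A)"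
    using K by linarith
  then show ?thesis by (simp add: card_E)
qed

end

section \<open>The algorithm\<close>

definition relabel :: "('a \<Rightarrow> 'b) \<Rightarrow> 'a word \<Rightarrow> 'b word" where
  "relabel d w = map (map_prod d id) w"

text \<open>The test applied by the search. \<open>P\<close> decides which words represent elements of the kernel, and \<open>ks\<close>
  lists the numbers of the generators. The third conjunct says that the entries of \<open>T\<close> represent
  pairwise different elements of the quotient, so that lengths of lists of words are cardinalities
  of subsets of the quotient.\<close>

definition quotient_folner :: "(nat word \<Rightarrow> bool) \<Rightarrow> nat list \<Rightarrow> nat \<Rightarrow> nat word list \<Rightarrow> bool" where
  "quotient_folner P ks m T \<longleftrightarrow>
    T \<noteq> [] \<and>
    (\<forall>t\<in>set T. \<forall>l\<in>set t. fst l \<in> set ks) \<and>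
    (\<forall>t\<in>set T. length (filter (\<lambda>u. P (word_inverse t @ u)) T) = 1) \<and>
    (\<forall>k\<in>set ks. m * length (filter (\<lambda>u. \<forall>t\<in>set T. \<not> P (word_inverse u @ (k, True) # t)) T) \<le> length T)"

text \<open>The kernel elements by which the representatives fail to be permuted when a generator acts.\<close>

definition cocycle_words :: "(nat word \<Rightarrow> bool) \<Rightarrow> nat list \<Rightarrow> nat word list \<Rightarrow> nat word list" where
  "cocycle_words P ks T =
    filter P (concat (map (\<lambda>k. concat (map (\<lambda>t. map (\<lambda>u. word_inverse u @ (k, True) # t) T) T)) ks))"

text \<open>In each round of the iteration a word is either taken from \<open>B\<close> or is an earlier word prolonged by \<open>s\<close>,
  so \<open>M\<close> rounds that start with the empty list give the exponents below \<open>M\<close>.\<close>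

definition box_words :: "nat \<Rightarrow> 'a word list \<Rightarrow> 'a word list" where
  "box_words M S = foldr (\<lambda>s B. ((\<lambda>C. B @ map ((@) s) C) ^^ M) []) S [[]]"

definition folner_words :: "(nat word \<Rightarrow> bool) \<Rightarrow> nat list \<Rightarrow> nat \<Rightarrow> nat word list \<Rightarrow> nat word list" where
  "folner_words P ks M T =
    concat (map (\<lambda>t. map (\<lambda>a. reduce (t @ a)) (box_words M (cocycle_words P ks T))) T)"

definition decode_words :: "nat \<Rightarrow> nat word list" where
  "decode_words z =
    map (\<lambda>w. map (\<lambda>l. (fst (prod_decode l), snd (prod_decode l) = 0)) (list_decode w)) (list_decode z)"

lemma enc_letter: "enc (k :: nat, s) = prod_encode (k, if s then 0 else 1)"
  by (simp add: enc_prod_def enc_nat_def enc_bool_def)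

lemma decode_words_enc: "decode_words (enc T) = T"
proof -
  have "(fst (prod_decode (enc l)), snd (prod_decode (enc l)) = 0) = l" for l :: "nat \<times> bool"
    by (cases l) (simp add: enc_letter)
  then show ?thesis by (simp add: decode_words_def enc_list_def comp_def)
qed

lemma effective_tl [effective_intros]:
  assumes "effective f"
  shows "effective (\<lambda>x. tl (f x))"
proof (rule effective_compose[OF _ assms])
  have "snd (prod_decode (enc xs - 1)) = enc (tl xs)" for xs :: "'b list"
  proof (cases xs)
    case Nil
    have "prod_encode (0, 0) = 0" by (simp add: prod_encode_def)
    then have "prod_decode 0 = (0, 0)" using prod_encode_inverse[of "(0, 0)"] by simp
    with Nil show ?thesis by (simp add: enc_list_def)
  qed (simp add: enc_list_def)
  then show "effective (tl :: 'b list \<Rightarrow> 'b list)"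
    unfolding effective_def
    by (intro exI[of _ "\<lambda>n. snd (prod_decode (n - 1))"])
      (simp add: computable_compose[OF computable_snd_decode computable_pred, simplified])
qed

lemma effective_eq_letter [effective_intros]:
  fixes f g :: "'a :: codable \<Rightarrow> nat \<times> bool"
  assumes "effective f" "effective g"
  shows "effective (\<lambda>x. f x = g x)"
  unfolding prod_eq_iff using assms by (intro effective_intros)

lemma effective_inv_letter [effective_intros]:
  fixes f :: "'a :: codable \<Rightarrow> nat \<times> bool"
  shows "effective f \<Longrightarrow> effective (\<lambda>x. inv_letter (f x))"
  unfolding inv_letter_def by (intro effective_intros)

lemma effective_word_inverse [effective_intros]:
  fixes f :: "'a :: codable \<Rightarrow> nat word"
  shows "effective f \<Longrightarrow> effective (\<lambda>x. word_inverse (f x))"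
  unfolding word_inverse_def by (intro effective_intros)

lemma effective_cons_reduce [effective_intros]:
  fixes f :: "'a :: codable \<Rightarrow> nat \<times> bool"
  assumes "effective f" "effective g"
  shows "effective (\<lambda>x. cons_reduce (f x) (g x))"
proof -
  \<comment> \<open>The fold returns the head of the word, and \<open>l\<close> for the empty word; as \<open>l\<close> is not its own
    inverse, the test then fails.\<close>
  have "cons_reduce l w = (if foldr (\<lambda>m _. m) w l = inv_letter l then tl w else l # w)"
    for l :: "nat \<times> bool" and w
    by (cases w) (auto simp: inv_letter_def prod_eq_iff)
  moreover have "effective (\<lambda>x. if foldr (\<lambda>m _. m) (g x) (f x) = inv_letter (f x) then tl (g x) else f x # g x)"
    by (intro effective_intros assms)
  ultimately show ?thesis by simp
qed

lemma effective_reduce [effective_intros]: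
  fixes f :: "'a :: codable \<Rightarrow> nat word"
  shows "effective f \<Longrightarrow> effective (\<lambda>x. reduce (f x))"
  unfolding reduce_def by (intro effective_intros)

lemma effective_mem [effective_intros]:
  fixes f :: "'a :: codable \<Rightarrow> nat"
  assumes "effective f" "effective xs"
  shows "effective (\<lambda>x. f x \<in> set (xs x))"
proof -
  have "effective (\<lambda>x. \<not> (\<forall>a\<in>set (xs x). \<not> f x = a))"
    by (intro effective_intros assms effective_compose[OF assms(1)])
  then show ?thesis by simp
qed

lemma effective_is_Nil:
  assumes "effective f"
  shows "effective (\<lambda>x. f x = [])"
  using effective_is_zero[OF effective_length[OF assms]] by simp

lemma effective_quotient_folner:
  assumes P: "effective P" and "effective m" "effective T"
  shows "effective (\<lambda>x. quotient_folner P ks (m x) (T x))"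
  unfolding quotient_folner_def
  by (intro effective_intros effective_is_Nil effective_compose[OF P]
      effective_compose[OF assms(2)] effective_compose[OF assms(3)] assms)

lemma effective_cocycle_words [effective_intros]:
  assumes P: "effective P" and "effective T"
  shows "effective (\<lambda>x. cocycle_words P ks (T x))"
  unfolding cocycle_words_def
  by (intro effective_intros effective_compose[OF P] effective_compose[OF assms(2)] assms(2))

lemma effective_box_words [effective_intros]:
  fixes S :: "'a :: codable \<Rightarrow> nat word list"
  assumes "effective M" "effective S"
  shows "effective (\<lambda>x. box_words (M x) (S x))"
  unfolding box_words_def
  by (intro effective_intros effective_compose[OF assms(1)] assms)

lemma effective_folner_words:
  assumes P: "effective P" and "effective M" "effective T"
  shows "effective (\<lambda>x. folner_words P ks (M x) (T x))"
  unfolding folner_words_def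
  by (intro effective_intros effective_compose[OF assms(2)] effective_compose[OF assms(3)] assms)

lemma effective_decode_words: "effective decode_words"
  unfolding decode_words_def
  by (intro effective_intros effective_compose[OF effective_list_decode] effective_compose[OF effective_prod_decode])

section \<open>Correctness of the algorithm\<close>

lemma (in group_hom) inv_mult_mem_kernel_iff:
  assumes "a \<in> carrier G" "b \<in> carrier G"
  shows "inv a \<otimes> b \<in> kernel G H h \<longleftrightarrow> h a = h b"
proof -
  have "h (inv a \<otimes> b) = inv\<^bsub>H\<^esub> h a \<otimes>\<^bsub>H\<^esub> h b" using assms by simp
  moreover have "inv\<^bsub>H\<^esub> h a \<otimes>\<^bsub>H\<^esub> h b = \<one>\<^bsub>H\<^esub> \<longleftrightarrow> h a = h b"
    using assms H.mult_inv_cancel[of "h a" "h b"] by (metis H.l_inv H.r_one hom_closed)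
  ultimately show ?thesis using assms by (simp add: kernel_def)
qed

text \<open>The algorithm works with words over the numbers of the generators, while the group is generated by
  the generators themselves; \<open>ev\<close> is the evaluation of words of the former kind.\<close>

locale coded_kernel = group_hom G H h
  for G (structure) and H (structure) and h +
  fixes X :: "'a set" and c :: "'a \<Rightarrow> nat" and ks :: "nat list" and P :: "nat word \<Rightarrow> bool"
  assumes X: "X \<subseteq> carrier G" and inj: "inj_on c X" and ks: "set ks = c ` X"
    and P: "w \<in> words (c ` X) \<Longrightarrow> P w \<longleftrightarrow> word_eval G (relabel (inv_into X c) w) \<in> kernel G H h"
begin

definition ev :: "nat word \<Rightarrow> 'a" where
  "ev w = word_eval G (relabel (inv_into X c) w)"

lemma relabel_words: "w \<in> words (c ` X) \<Longrightarrow> relabel (inv_into X c) w \<in> words X"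
  by (auto simp: words_iff relabel_def inv_into_into)

lemma ev_closed: "w \<in> words (c ` X) \<Longrightarrow> ev w \<in> carrier G"
  unfolding ev_def by (intro G.word_eval_closed[OF X] relabel_words)

lemma ev_append: "u \<in> words (c ` X) \<Longrightarrow> v \<in> words (c ` X) \<Longrightarrow> ev (u @ v) = ev u \<otimes> ev v"
  unfolding ev_def using G.word_eval_append[OF X relabel_words relabel_words, of u v]
  by (simp add: relabel_def)

lemma ev_Nil: "ev [] = \<one>"
  by (simp add: ev_def relabel_def G.word_eval_Nil)

lemma ev_inverse: "w \<in> words (c ` X) \<Longrightarrow> ev (word_inverse w) = inv (ev w)"
proof -
  assume w: "w \<in> words (c ` X)"
  have "relabel d (word_inverse w) = word_inverse (relabel d w)" for d :: "nat \<Rightarrow> 'a"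
    by (simp add: relabel_def word_inverse_def rev_map[symmetric] inv_letter_def)
  then show ?thesis unfolding ev_def using G.word_eval_inverse[OF X relabel_words[OF w]] by simp
qed

lemma ev_Cons:
  assumes "x \<in> X" "t \<in> words (c ` X)"
  shows "ev ((c x, True) # t) = x \<otimes> ev t"
proof -
  have "ev [(c x, True)] = x"
    using assms(1) inj X by (auto simp: ev_def relabel_def G.word_eval_generator)
  then show ?thesis
    using ev_append[of "[(c x, True)]" t] assms by (simp add: words_simps)
qed

lemma P_iff: "w \<in> words (c ` X) \<Longrightarrow> P w \<longleftrightarrow> ev w \<in> kernel G H h"
  using P by (simp add: ev_def)

lemma P_same_coset_iff:
  assumes "t \<in> words (c ` X)" "u \<in> words (c ` X)"
  shows "P (word_inverse t @ u) \<longleftrightarrow> h (ev t) = h (ev u)"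
  using assms inv_mult_mem_kernel_iff[OF ev_closed ev_closed, of t u]
  by (simp add: P_iff words_simps ev_append ev_inverse)

lemma ev_cocycle:
  assumes "x \<in> X" "t \<in> words (c ` X)" "u \<in> words (c ` X)"
  shows "ev (word_inverse u @ (c x, True) # t) = inv (ev u) \<otimes> (x \<otimes> ev t)"
  using assms by (simp add: words_simps ev_append ev_inverse ev_Cons)

lemma P_cocycle_iff:
  assumes "x \<in> X" "t \<in> words (c ` X)" "u \<in> words (c ` X)"
  shows "P (word_inverse u @ (c x, True) # t) \<longleftrightarrow> inv (ev u) \<otimes> (x \<otimes> ev t) \<in> kernel G H h"
  using assms ev_cocycle[OF assms] by (simp add: P_iff words_simps)

text \<open>The search succeeds: lift the elements of an almost invariant set of the quotient to words.\<close>

lemma quotient_folner_exists: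
  assumes "finite X" "generate G X = carrier G" "h ` carrier G = carrier H" "amenable H"
  shows "\<exists>T. quotient_folner P ks m T"
proof -
  have "finite (h ` X)" "h ` X \<subseteq> carrier H" using assms(1) X by auto
  then obtain F where F: "finite F" "F \<noteq> {}" "F \<subseteq> carrier H"
      "\<And>z. z \<in> h ` X \<Longrightarrow> m * card (F - (z <#\<^bsub>H\<^esub> F)) \<le> card F"
    using H.amenable_finite_subset[OF assms(4)] by metis
  have "\<exists>w. w \<in> words (c ` X) \<and> h (ev w) = f" if f: "f \<in> F" for f
  proof -
    have "f \<in> h ` carrier G" unfolding assms(3) using f F(3) by (rule subsetD[rotated])
    then obtain g where g: "g \<in> carrier G" "h g = f" by blast
    then obtain v where v: "v \<in> words X" "g = word_eval G v"
      using G.generate_eq_word_eval[OF X] assms(2) by blast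
    have "relabel (inv_into X c) (relabel c v) = v"
      using v(1) inj unfolding relabel_def map_map words_iff by (intro map_idI) auto
    moreover have "relabel c v \<in> words (c ` X)" using v(1) by (auto simp: words_iff relabel_def)
    ultimately show ?thesis using g v by (intro exI[of _ "relabel c v"]) (simp add: ev_def)
  qed
  then obtain r where r: "\<And>f. f \<in> F \<Longrightarrow> r f \<in> words (c ` X)" "\<And>f. f \<in> F \<Longrightarrow> h (ev (r f)) = f"
    by metis
  obtain fs where fs: "set fs = F" "distinct fs" using finite_distinct_list[OF F(1)] by blast
  have inj_r: "inj_on r F" by (metis inj_onI r(2))
  let ?T = "map r fs"
  have T: "set ?T = r ` F" "distinct ?T" "length ?T = card F"
    using inj_r distinct_card[OF fs(2)] by (simp_all add: distinct_map fs)
  have len: "length (filter Q ?T) = card (r ` F \<inter> Collect Q)" for Q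
  proof -
    have "set (filter Q ?T) = r ` F \<inter> Collect Q" unfolding set_filter T(1) by blast
    then show ?thesis using distinct_card[OF distinct_filter[OF T(2)], of Q] by argo
  qed
  have "quotient_folner P ks m ?T"
    unfolding quotient_folner_def
  proof (intro conjI ballI)
    show "?T \<noteq> []" using F(2) fs(1) by auto
  next
    fix t l assume "t \<in> set ?T" "l \<in> set t"
    then have "t \<in> words (c ` X)" using T(1) r(1) by auto
    then show "fst l \<in> set ks" using \<open>l \<in> set t\<close> by (simp add: words_iff ks)
  next
    fix t assume "t \<in> set ?T"
    then obtain f where f: "f \<in> F" "t = r f" using T(1) by auto
    have "r ` F \<inter> {u. P (word_inverse t @ u)} = {t}"
    proof (intro equalityI subsetI)
      fix u assume "u \<in> r ` F \<inter> {u. P (word_inverse t @ u)}"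
      then obtain f' where "f' \<in> F" "u = r f'" "P (word_inverse t @ u)" by auto
      then have "f = f'" using f P_same_coset_iff[of t u] r by simp
      then show "u \<in> {t}" using f \<open>u = r f'\<close> by simp
    qed (use f P_same_coset_iff[of t t] r in auto)
    then show "length (filter (\<lambda>u. P (word_inverse t @ u)) ?T) = 1" by (simp only: len) simp
  next
    fix k assume "k \<in> set ks"
    then obtain x where x: "x \<in> X" "k = c x" using ks by auto
    have hx: "h x \<in> carrier H" "x \<in> carrier G" using x X by auto
    let ?Q = "\<lambda>u. \<forall>t\<in>set ?T. \<not> P (word_inverse u @ (k, True) # t)"
    have "r ` F \<inter> Collect ?Q \<subseteq> r ` (F - (h x <#\<^bsub>H\<^esub> F))"
    proof
      fix u assume "u \<in> r ` F \<inter> Collect ?Q"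
      then obtain f where f: "f \<in> F" "u = r f" and Q: "?Q u" by auto
      have "f \<notin> h x <#\<^bsub>H\<^esub> F"
      proof
        assume "f \<in> h x <#\<^bsub>H\<^esub> F"
        then obtain f' where f': "f' \<in> F" "f = h x \<otimes>\<^bsub>H\<^esub> f'" by (auto simp: H.l_coset_eq_image)
        have G: "ev (r f) \<in> carrier G" "ev (r f') \<in> carrier G" using r(1) f f' ev_closed by auto
        have "h (ev (r f)) = h (x \<otimes> ev (r f'))" using f f' r(2) hx G by simp
        then have "P (word_inverse u @ (k, True) # r f')"
          using f f' x r(1) hx G by (simp add: P_cocycle_iff inv_mult_mem_kernel_iff)
        with Q f' T(1) show False by blast
      qed
      with f show "u \<in> r ` (F - (h x <#\<^bsub>H\<^esub> F))" by auto
    qed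
    then have "card (r ` F \<inter> Collect ?Q) \<le> card (r ` (F - (h x <#\<^bsub>H\<^esub> F)))"
      using F(1) by (intro card_mono) auto
    also have "\<dots> \<le> card (F - (h x <#\<^bsub>H\<^esub> F))" using F(1) by (intro card_image_le) auto
    finally have "m * card (r ` F \<inter> Collect ?Q) \<le> m * card (F - (h x <#\<^bsub>H\<^esub> F))" by simp
    also have "\<dots> \<le> card F" using F(4) x by blast
    finally show "m * length (filter ?Q ?T) \<le> length ?T" unfolding len T(3) .
  qed
  then show ?thesis by blast
qed

text \<open>Only one position of \<open>T\<close> passes the filter in the third conjunct of the test, and the position of
  \<open>t\<close> itself does. So entries with the same image in the quotient stand at the same position, which
  shows that the entries are distinct and that the images are distinct.\<close>

lemma quotient_folnerD:
  assumes "quotient_folner P ks m T"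
  shows "set T \<subseteq> words (c ` X)" "inj_on ev (set T)" "inj_on h (ev ` set T)"
    and "x \<in> X \<Longrightarrow> m * card {u \<in> ev ` set T. \<forall>t\<in>ev ` set T. inv u \<otimes> (x \<otimes> t) \<notin> kernel G H h} \<le> card (ev ` set T)"
proof -
  show TW: "set T \<subseteq> words (c ` X)"
    using assms by (auto simp: quotient_folner_def words_iff ks)
  have nth: "i = j" if "i < length T" "j < length T" "h (ev (T ! i)) = h (ev (T ! j))" for i j
  proof -
    have "card {k. k < length T \<and> P (word_inverse (T ! i) @ T ! k)} = 1"
      using assms \<open>i < length T\<close> unfolding quotient_folner_def by (simp add: length_filter_conv_card)
    then obtain k where k: "{k. k < length T \<and> P (word_inverse (T ! i) @ T ! k)} = {k}"
      by (rule card_1_singletonE)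
    have "P (word_inverse (T ! i) @ T ! l)" if "l \<in> {i, j}" for l
      using TW that \<open>i < length T\<close> \<open>j < length T\<close> \<open>h (ev (T ! i)) = h (ev (T ! j))\<close>
      by (auto simp: P_same_coset_iff subset_iff)
    then have "i \<in> {k. k < length T \<and> P (word_inverse (T ! i) @ T ! k)}"
        "j \<in> {k. k < length T \<and> P (word_inverse (T ! i) @ T ! k)}"
      using \<open>i < length T\<close> \<open>j < length T\<close> by auto
    then have "i \<in> {k}" "j \<in> {k}" unfolding k .
    then show ?thesis by simp
  qed
  have dist: "distinct T" unfolding distinct_conv_nth using nth by metis
  have inj_hev: "inj_on (h \<circ> ev) (set T)"
  proof (rule inj_onI)
    fix s t assume "s \<in> set T" "t \<in> set T" and eq: "(h \<circ> ev) s = (h \<circ> ev) t"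
    then obtain i j where "i < length T" "s = T ! i" "j < length T" "t = T ! j"
      by (metis in_set_conv_nth)
    with nth[of i j] eq show "s = t" by simp
  qed
  then show inj_ev: "inj_on ev (set T)" by (rule inj_on_imageI2)
  show "inj_on h (ev ` set T)" using inj_hev by (rule inj_on_imageI)
  assume x: "x \<in> X"
  let ?Q = "\<lambda>u. \<forall>t\<in>set T. \<not> P (word_inverse u @ (c x, True) # t)"
  have "{u \<in> ev ` set T. \<forall>t\<in>ev ` set T. inv u \<otimes> (x \<otimes> t) \<notin> kernel G H h} = ev ` {u \<in> set T. ?Q u}"
    using TW x by (auto simp: P_cocycle_iff subset_iff)
  also have "card \<dots> = card {u \<in> set T. ?Q u}"
    using inj_ev by (intro card_image inj_on_subset[OF inj_ev]) auto
  also have "\<dots> = length (filter ?Q T)"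
    using distinct_card[of "filter ?Q T"] dist by simp
  finally show "m * card {u \<in> ev ` set T. \<forall>t\<in>ev ` set T. inv u \<otimes> (x \<otimes> t) \<notin> kernel G H h} \<le> card (ev ` set T)"
    using assms x ks by (simp add: quotient_folner_def card_image[OF inj_ev] distinct_card[OF dist])
qed

lemma set_cocycle_words:
  "set (cocycle_words P ks T) =
    {w. P w \<and> (\<exists>x\<in>X. \<exists>t\<in>set T. \<exists>u\<in>set T. w = word_inverse u @ (c x, True) # t)}"
  by (auto simp: cocycle_words_def ks)

lemma set_box_words_Cons:
  "set (box_words M (s # S)) = (\<lambda>(k, b). concat (replicate k s) @ b) ` ({..<M} \<times> set (box_words M S))"
proof -
  have "set (((\<lambda>C. B @ map ((@) s) C) ^^ M) []) =
      (\<lambda>(k, b). concat (replicate k s) @ b) ` ({..<M} \<times> set B)" (is "_ = ?f ` _") for B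
  proof (induction M)
    case (Suc M)
    have "{..<Suc M} \<times> set B = Pair 0 ` set B \<union> map_prod Suc id ` ({..<M} \<times> set B)"
      unfolding lessThan_Suc_eq_insert_0 map_prod_def by force
    then have "?f ` ({..<Suc M} \<times> set B) =
        (\<lambda>b. ?f (0, b)) ` set B \<union> (\<lambda>p. ?f (map_prod Suc id p)) ` ({..<M} \<times> set B)"
      by (simp only: image_Un image_image)
    also have "\<dots> = set B \<union> (\<lambda>p. s @ ?f p) ` ({..<M} \<times> set B)"
      by (intro arg_cong2[of _ _ _ _ "(\<union>)"] image_cong) auto
    also have "\<dots> = set B \<union> (@) s ` ?f ` ({..<M} \<times> set B)"
      by (simp only: image_image)
    finally show ?case using Suc.IH by simp
  qed simp
  then show ?thesis by (simp add: box_words_def)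
qed

lemma ev_box_words:
  assumes "set S \<subseteq> words (c ` X)"
  shows "set (box_words M S) \<subseteq> words (c ` X) \<and> ev ` set (box_words M S) = power_box G M (map ev S)"
  using assms
proof (induction S)
  case Nil
  show ?case by (simp add: box_words_def words_Nil ev_Nil)
next
  case (Cons s S)
  then have s: "s \<in> words (c ` X)" and B: "set (box_words M S) \<subseteq> words (c ` X)"
      "ev ` set (box_words M S) = power_box G M (map ev S)" by auto
  have pow: "concat (replicate k s) \<in> words (c ` X) \<and> ev (concat (replicate k s)) = ev s [^] k" for k
  proof (induction k)
    case (Suc k)
    have "ev s [^] Suc k = ev s \<otimes> ev s [^] k" using ev_closed[OF s] by (rule G.nat_pow_Suc2)
    with Suc s show ?case by (simp add: words_simps ev_append del: G.nat_pow_Suc)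
  qed (simp add: words_Nil ev_Nil)
  have "ev (concat (replicate k s) @ b) = ev s [^] k \<otimes> ev b" if "b \<in> set (box_words M S)" for k b
    using that pow[of k] B(1) by (simp add: ev_append subset_iff)
  then have "ev ` set (box_words M (s # S)) =
      (\<lambda>(k, b). ev s [^] k \<otimes> ev b) ` ({..<M} \<times> set (box_words M S))"
    unfolding set_box_words_Cons image_image by (intro image_cong) auto
  also have "\<dots> = power_box G M (map ev (s # S))"
    unfolding list.map power_box.simps B(2)[symmetric] by force
  finally show ?case
    using pow B(1) by (auto simp: set_box_words_Cons words_append)
qed

lemma relabel_reduce:
  assumes "w \<in> words (c ` X)"
  shows "relabel (inv_into X c) (reduce w) = reduce (relabel (inv_into X c) w)"
  using assms
proof (induction w)
  case Nil
  show ?case by (simp add: relabel_def reduce_def)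
next
  case (Cons l w)
  let ?d = "map_prod (inv_into X c) id :: nat \<times> bool \<Rightarrow> 'a \<times> bool"
  have cons: "map ?d (cons_reduce l v) = cons_reduce (?d l) (map ?d v)"
    if v: "v \<in> words (c ` X)" for v
  proof (cases v)
    case (Cons m v')
    have "fst m \<in> c ` X" "fst l \<in> c ` X" using v Cons Cons.prems \<open>l # w \<in> words (c ` X)\<close>
      by (auto simp: words_simps)
    then have "inv_into X c (fst m) = inv_into X c (fst l) \<longleftrightarrow> fst m = fst l"
      using inj_on_inv_into[of "c ` X" c X] by (auto dest: inj_onD)
    then have "?d m = inv_letter (?d l) \<longleftrightarrow> m = inv_letter l"
      by (cases m; cases l) (auto simp: inv_letter_def)
    with Cons show ?thesis by simp
  qed simp
  have "reduce w \<in> words (c ` X)" "relabel (inv_into X c) (reduce w) = reduce (relabel (inv_into X c) w)"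
    using Cons by (auto simp: words_simps words_reduce)
  then show ?case using cons[of "reduce w"] by (simp add: relabel_def reduce_def)
qed

text \<open>The bound \<open>2 * n\<close> is used twice, for the set in the quotient and for the exponents of the box, because
  both parts contribute to the defect.\<close>

lemma folner_words_correct:
  assumes comm: "\<And>a b. a \<in> kernel G H h \<Longrightarrow> b \<in> kernel G H h \<Longrightarrow> a \<otimes> b = b \<otimes> a"
    and n: "n \<ge> 1" and T: "quotient_folner P ks (2 * n) T"
  defines "F \<equiv> relabel (inv_into X c) ` set (folner_words P ks (2 * n) T)"
  shows "finite F \<and> F \<subseteq> carrier (free_group X) \<and>
    word_code c ` F = enc ` set (folner_words P ks (2 * n) T) \<and> folner_set G X n (word_eval G ` F)"
proof -
  note TD = quotient_folnerD[OF T]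
  define S where "S = cocycle_words P ks T"
  define A where "A = power_box G (2 * n) (map ev S)"
  let ?W = "words (c ` X)" and ?d = "relabel (inv_into X c)" and ?B = "set (box_words (2 * n) S)"
  have S: "set S \<subseteq> ?W"
    using TD(1) by (auto simp: S_def set_cocycle_words words_append words_Cons intro!: word_inverse_words)
  have evS: "ev ` set S \<subseteq> kernel G H h" using S P_iff by (auto simp: S_def set_cocycle_words)
  have B: "?B \<subseteq> ?W" "ev ` ?B = A" using ev_box_words[OF S, of "2 * n"] by (auto simp: A_def)
  have E: "set (folner_words P ks (2 * n) T) = {reduce (t @ a) | t a. t \<in> set T \<and> a \<in> ?B}"
    by (auto simp: folner_words_def S_def)
  have F: "F = {reduce (?d (t @ a)) | t a. t \<in> set T \<and> a \<in> ?B}"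
  proof -
    have "?d (reduce (t @ a)) = reduce (?d (t @ a))" if "t \<in> set T" "a \<in> ?B" for t a
      using that TD(1) B(1) by (intro relabel_reduce) (auto simp: words_simps)
    then show ?thesis unfolding F_def E by (auto simp: image_def) metis+
  qed
  have "F \<subseteq> carrier (free_group X)"
    using TD(1) B(1) by (auto simp: F free_group_def reduced_reduce words_simps intro!: words_reduce relabel_words)
  moreover have "word_code c ` F = enc ` set (folner_words P ks (2 * n) T)"
  proof -
    have "word_code c (?d w) = enc w" if "w \<in> ?W" for w
      using that unfolding word_code_def enc_list_def relabel_def map_map
      by (intro arg_cong[of _ _ list_encode] map_cong) (auto simp: words_iff enc_letter f_inv_into_f)
    moreover have "set (folner_words P ks (2 * n) T) \<subseteq> ?W"
      using TD(1) B(1) by (auto simp: E words_simps intro!: words_reduce)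
    ultimately show ?thesis unfolding F_def image_image by (intro image_cong) auto
  qed
  moreover have "word_eval G ` F = (ev ` set T) <#> A"
  proof -
    have "word_eval G (reduce (?d (t @ a))) = ev t \<otimes> ev a" if "t \<in> set T" "a \<in> ?B" for t a
      using that TD(1) B(1) ev_append[of t a] G.word_eval_reduce[OF X relabel_words, of "t @ a"]
      by (auto simp: words_simps ev_def subset_iff)
    then have "word_eval G ` F = {ev t \<otimes> ev a | t a. t \<in> set T \<and> a \<in> ?B}"
      unfolding F by (auto simp: image_def) metis+
    then show ?thesis unfolding B(2)[symmetric] by (auto simp: set_mult_def)
  qed
  moreover have "folner_set G X n ((ev ` set T) <#> A)"
    unfolding G.folner_set_iff[OF n]
  proof (intro conjI ballI)
    have K: "subgroup (kernel G H h) G" by (rule subgroup_kernel)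
    have A: "finite A" "A \<noteq> {}" "A \<subseteq> kernel G H h"
      using n evS G.power_box_subgroup[OF K, of "map ev S" "2 * n"]
      by (auto simp: A_def G.finite_power_box G.power_box_nonempty)
    have AG: "A \<subseteq> carrier G" using A(3) by (auto simp: kernel_def)
    have TG: "ev ` set T \<subseteq> carrier G" using TD(1) ev_closed by auto
    show "finite ((ev ` set T) <#> A)" using A(1) by (auto simp: set_mult_def)
    show "(ev ` set T) <#> A \<noteq> {}" using A(2) T by (auto simp: set_mult_def quotient_folner_def)
    show "(ev ` set T) <#> A \<subseteq> carrier G" using AG TG by (rule G.set_mult_closed[rotated])
    fix x assume x: "x \<in> X"
    show "n * card (((ev ` set T) <#> A) - (x <# ((ev ` set T) <#> A))) \<le> card ((ev ` set T) <#> A)"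
    proof (rule card_Diff_l_coset_transversal[OF _ TG TD(3) A(1,3) _ TD(4)[OF x]])
      fix t u assume "t \<in> ev ` set T" "u \<in> ev ` set T" and k: "inv u \<otimes> (x \<otimes> t) \<in> kernel G H h"
      then obtain t' u' where tu: "t' \<in> set T" "u' \<in> set T" "t = ev t'" "u = ev u'" by blast
      then have W: "t' \<in> ?W" "u' \<in> ?W" using TD(1) by auto
      have "word_inverse u' @ (c x, True) # t' \<in> set S"
        using tu x k W P_cocycle_iff[of x t' u'] by (auto simp: S_def set_cocycle_words)
      then have "inv u \<otimes> (x \<otimes> t) \<in> set (map ev S)"
        using ev_cocycle[OF x W] tu by (metis image_eqI set_map)
      then show "2 * n * card (A - (inv u \<otimes> (x \<otimes> t) <# A)) \<le> card A"
        unfolding A_def using evS by (intro G.card_Diff_l_coset_power_box[OF K comm]) auto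
    qed (use x X in auto)
  qed
  ultimately show ?thesis by (auto simp: F_def)
qed

end

lemma word_code_eq_enc: "word_code c w = enc (relabel c w)"
  unfolding word_code_def enc_list_def relabel_def map_map
  by (intro arg_cong[of _ _ list_encode] map_cong) (auto simp: enc_letter)

lemma inj_enc_words: "inj (enc :: nat word \<Rightarrow> nat)"
proof (rule injI)
  fix u v :: "nat word" assume "enc u = enc v"
  then have "map enc u = map enc v"
    using inj_list_encode by (auto simp: enc_list_def dest: inj_onD)
  moreover have "inj (enc :: nat \<times> bool \<Rightarrow> nat)"
    by (intro injI) (auto simp: enc_letter split: if_splits)
  ultimately show "u = v" by simp
qed

text \<open>A word over the generators of \<open>G\<close> is rewritten into a word over the generators of the quotient for
  which the word problem is solvable, by substituting a fixed word for each letter and each inverse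
  letter.\<close>

lemma (in group_hom) effective_kernel:
  assumes X: "finite X" "X \<subseteq> carrier G" "inj_on c X" and "solvable_word_problem H"
  obtains P :: "nat word \<Rightarrow> bool" where "effective P"
    "\<And>w. w \<in> words (c ` X) \<Longrightarrow> P w \<longleftrightarrow> word_eval G (relabel (inv_into X c) w) \<in> kernel G H h"
proof -
  obtain Y c' where Y: "generating_set H Y" "inj_on c' Y" "solvable_WP_wrt H Y c'"
    using assms(4) by (auto simp: solvable_word_problem_def)
  then have YH: "Y \<subseteq> carrier H" "generate H Y = carrier H" by (auto simp: generating_set_def)
  define A where "A = word_code c' ` {w \<in> words Y. word_eval H w = \<one>\<^bsub>H\<^esub>}"
  have A: "effective (\<lambda>n. n \<in> A)"
    using Y(3) by (simp add: solvable_WP_wrt_def decidable_iff_effective A_def)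
  let ?d = "inv_into X c"
  have "\<exists>v. v \<in> words Y \<and> word_eval H v = h (word_eval G [(?d k, s)])" if "k \<in> c ` X" for k s
  proof -
    have "?d k \<in> carrier G" by (rule subsetD[OF X(2) inv_into_into[OF that]])
    then have "h (word_eval G [(?d k, s)]) \<in> carrier H"
      by (auto simp: G.word_eval_generator)
    then show ?thesis using H.generate_eq_word_eval[OF YH(1)] YH(2) by force
  qed
  then obtain v where v: "\<And>k s. k \<in> c ` X \<Longrightarrow> v k s \<in> words Y"
      "\<And>k s. k \<in> c ` X \<Longrightarrow> word_eval H (v k s) = h (word_eval G [(?d k, s)])"
    by metis
  \<comment> \<open>The substitution, for the two signs of a letter, as tables indexed by the numbers of generators.\<close>
  define \<sigma> where "\<sigma> s k = (if k \<in> c ` X then relabel c' (v k s) else [])" for s k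
  define P where "P w = (enc (concat (map (\<lambda>l. if snd l then \<sigma> True (fst l) else \<sigma> False (fst l)) w)) \<in> A)"
    for w :: "nat word"
  have \<sigma>: "effective (\<sigma> s)" for s
    unfolding \<sigma>_def[abs_def] using X(1) by (intro effective_finite_table) auto
  have "effective P"
    unfolding P_def
    by (intro effective_compose[OF A] effective_compose[OF effective_enc] effective_compose[OF \<sigma>] effective_intros)
  moreover have "P w \<longleftrightarrow> word_eval G (relabel ?d w) \<in> kernel G H h" if w: "w \<in> words (c ` X)" for w
  proof -
    define V where "V = concat (map (\<lambda>l. v (fst l) (snd l)) w)"
    have "concat (map (\<lambda>l. if snd l then \<sigma> True (fst l) else \<sigma> False (fst l)) w) = relabel c' V"
    proof -
      have "concat (map (\<lambda>l. if snd l then \<sigma> True (fst l) else \<sigma> False (fst l)) w) =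
          concat (map (\<lambda>l. relabel c' (v (fst l) (snd l))) w)"
        using w by (intro arg_cong[of _ _ concat] map_cong) (auto simp: words_iff \<sigma>_def)
      then show ?thesis by (simp add: V_def relabel_def map_concat comp_def)
    qed
    then have Pw: "P w \<longleftrightarrow> word_code c' V \<in> A" by (simp add: P_def word_code_eq_enc)
    have V: "V \<in> words Y" "word_eval H V = h (word_eval G (relabel ?d w))" "word_eval G (relabel ?d w) \<in> carrier G"
    proof -
      have "V \<in> words Y \<and> word_eval H V = h (word_eval G (relabel ?d w)) \<and> relabel ?d w \<in> words X"
        unfolding V_def using w
      proof (induction w)
        case Nil
        show ?case by (simp add: words_Nil relabel_def G.word_eval_Nil H.word_eval_Nil)
      next
        case (Cons l w)
        let ?V = "concat (map (\<lambda>l. v (fst l) (snd l)) w)"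
        have l: "fst l \<in> c ` X" and IH: "?V \<in> words Y" "word_eval H ?V = h (word_eval G (relabel ?d w))" "relabel ?d w \<in> words X"
          using Cons by (auto simp: words_simps)
        have dl: "?d (fst l) \<in> X" using l by (simp add: inv_into_into)
        have eq: "relabel ?d (l # w) = [(?d (fst l), snd l)] @ relabel ?d w"
          by (cases l) (simp add: relabel_def)
        have l': "[(?d (fst l), snd l)] \<in> words X" using dl by (simp add: words_simps)
        have "word_eval G (relabel ?d (l # w)) = word_eval G [(?d (fst l), snd l)] \<otimes> word_eval G (relabel ?d w)"
          unfolding eq by (rule G.word_eval_append[OF X(2) l' IH(3)])
        then have "h (word_eval G (relabel ?d (l # w))) =
            h (word_eval G [(?d (fst l), snd l)]) \<otimes>\<^bsub>H\<^esub> h (word_eval G (relabel ?d w))"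
          using G.word_eval_closed[OF X(2)] l' IH(3) by simp
        moreover have "word_eval H (v (fst l) (snd l) @ ?V) =
            word_eval H (v (fst l) (snd l)) \<otimes>\<^bsub>H\<^esub> word_eval H ?V"
          by (rule H.word_eval_append[OF YH(1) v(1)[OF l] IH(1)])
        ultimately show ?case
          using IH v[OF l] dl eq by (simp add: words_simps)
      qed
      then show "V \<in> words Y" "word_eval H V = h (word_eval G (relabel ?d w))" "word_eval G (relabel ?d w) \<in> carrier G"
        using G.word_eval_closed[OF X(2)] by auto
    qed
    have "inj_on (word_code c') (words Y)"
    proof (rule inj_onI)
      fix a b assume ab: "a \<in> words Y" "b \<in> words Y" "word_code c' a = word_code c' b"
      then have "relabel c' a = relabel c' b"
        using injD[OF inj_enc_words] by (simp add: word_code_eq_enc)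
      moreover have "inj_on (map_prod c' id) (set a \<union> set b)"
      proof (rule inj_on_subset)
        show "inj_on (map_prod c' id) (Y \<times> UNIV)" by (rule map_prod_inj_on[OF Y(2) inj_on_id])
        show "set a \<union> set b \<subseteq> Y \<times> UNIV" using ab(1,2) by (auto simp: words_def)
      qed
      ultimately show "a = b" unfolding relabel_def by (rule map_inj_on)
    qed
    then have "word_code c' V \<in> A \<longleftrightarrow> word_eval H V = \<one>\<^bsub>H\<^esub>"
      unfolding A_def using V(1) by (auto dest: inj_onD)
    then show ?thesis using Pw V by (simp add: kernel_def)
  qed
  ultimately show ?thesis by (rule that)
qed

theorem (in group_hom) computable_folner_abelian_kernel:
  assumes surj: "h ` carrier G = carrier H"
    and comm: "\<And>a b. a \<in> kernel G H h \<Longrightarrow> b \<in> kernel G H h \<Longrightarrow> a \<otimes> b = b \<otimes> a"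
    and H: "amenable H" "solvable_word_problem H"
    and X: "generating_set G X" "inj_on c X"
  shows "computable_folner_wrt G X c"
proof -
  have X': "finite X" "X \<subseteq> carrier G" "generate G X = carrier G" using X(1) by (auto simp: generating_set_def)
  obtain P :: "nat word \<Rightarrow> bool" where P: "effective P"
    "\<And>w. w \<in> words (c ` X) \<Longrightarrow> P w \<longleftrightarrow> word_eval G (relabel (inv_into X c) w) \<in> kernel G H h"
    using effective_kernel[OF X'(1,2) X(2) H(2)] by blast
  obtain ks where ks: "set ks = c ` X" using finite_list[of "c ` X"] X'(1) by auto
  interpret coded: coded_kernel G H h X c ks P
    using X'(2) X(2) ks P(2) by unfold_locales
  have "effective (\<lambda>p. quotient_folner P ks (2 * fst p) (decode_words (snd p)))"
    by (intro effective_quotient_folner P(1) effective_compose[OF effective_decode_words] effective_intros)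
  moreover have "\<exists>z. quotient_folner P ks (2 * n) (decode_words z)" for n
    using coded.quotient_folner_exists[OF X'(1,3) surj H(1)] decode_words_enc by metis
  ultimately obtain g where g: "effective g" "\<And>n. quotient_folner P ks (2 * n) (decode_words (g n))"
    by (rule effective_search) blast
  define f where "f n = enc (folner_words P ks (2 * n) (decode_words (g n)))" for n :: nat
  have "effective f"
    unfolding f_def
    by (intro effective_compose[OF effective_enc] effective_folner_words P(1)
        effective_compose[OF effective_decode_words] g(1) effective_intros)
  then have "computable f" by (simp add: effective_iff_computable)
  moreover have "set (list_decode (f n)) = enc ` set (folner_words P ks (2 * n) (decode_words (g n)))" for n
    by (simp add: f_def enc_list_def)
  moreover have "\<exists>F. finite F \<and> F \<subseteq> carrier (free_group X) \<and>
      word_code c ` F = enc ` set (folner_words P ks (2 * n) (decode_words (g n))) \<and>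
      folner_set G X n (word_eval G ` F)" if "n \<ge> 1" for n
    by (rule exI) (rule coded.folner_words_correct[OF comm that g(2)])
  ultimately show ?thesis
    unfolding computable_folner_wrt_def by (intro exI[of _ f]) metis
qed

theorem corollary2p2:
  fixes \<Gamma> :: "('a, 'b) monoid_scheme" and N :: "'a set"
  assumes "group \<Gamma>"
    and "finitely_presented \<Gamma>"
    and "N \<lhd> \<Gamma>"
    and "comm_group (\<Gamma>\<lparr>carrier := N\<rparr>)"
    and "amenable (\<Gamma> Mod N)"
    and "solvable_word_problem (\<Gamma> Mod N)"
  shows "computable_folner_sets \<Gamma>"
proof -
  interpret N: normal N \<Gamma> by fact
  let ?p = "\<lambda>g. N #>\<^bsub>\<Gamma>\<^esub> g"
  interpret p: group_hom \<Gamma> "\<Gamma> Mod N" ?p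
    by (intro group_hom.intro group_hom_axioms.intro N.factorgroup_is_group N.r_coset_hom_Mod assms(1))
  have kernel: "kernel \<Gamma> (\<Gamma> Mod N) ?p = N"
    using N.coset_join1[OF _ _ N.subgroup_axioms] N.coset_join2[OF _ N.subgroup_axioms] N.subset
    by (auto simp: kernel_def FactGroup_def)
  have surj: "?p ` carrier \<Gamma> = carrier (\<Gamma> Mod N)"
    by (auto simp: FactGroup_def RCOSETS_def)
  have comm: "a \<otimes>\<^bsub>\<Gamma>\<^esub> b = b \<otimes>\<^bsub>\<Gamma>\<^esub> a" if "a \<in> N" "b \<in> N" for a b
    using comm_groupE(4)[OF assms(4), of a b] that by simp
  have "computable_folner_wrt \<Gamma> X c" if "generating_set \<Gamma> X" "inj_on c X" for X and c :: "'a \<Rightarrow> nat"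
    using that comm by (intro p.computable_folner_abelian_kernel[OF surj _ assms(5,6)]) (auto simp: kernel)
  moreover have "\<exists>X. generating_set \<Gamma> X"
    using assms(2) by (auto simp: finitely_presented_def)
  ultimately show ?thesis by (simp add: computable_folner_sets_def)
qed

end
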